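(* (i) Let $S\equiv\pm\{1, 6, 7, 8, 11, 13, 18, 19, 20, 21, 23, 25\}\pmod{60}$ and $T\equiv\pm\{1, 5, 6, 7, 13, 17, 18, 19, 20, 21, 28, 29\}\pmod{60}$. Then $p(S,n)=p(T,n-1)$ for all $n\geq 1$. (ii) Let $S\equiv\pm\{4, 5, 6, 7, 11, 13, 17, 18, 19, 20, 27, 29\}\pmod{60}$ and $T\equiv\pm\{1, 6, 7, 11, 13, 16, 18, 20, 23, 25, 27, 29\}\pmod{60}$. Then $p(S,n)=p(T,n-4)$ for all $n\geq 4$. (iii) Let $S\equiv\pm\{5, 6, 7, 8, 9, 11, 17, 18, 19, 20, 23, 29\}\pmod{60}$ and $T\equiv\pm\{1, 6, 9, 11, 13, 17, 18, 20, 23, 25, 28, 29\}\pmod{60}$. Then $p(S,n)=p(T,n-5)$ for all $n\geq 5$. (iv) Let $S\equiv\pm\{1, 3, 4, 6, 11, 13, 17, 18, 19, 20, 23, 25\}\pmod{60}$ and $T\equiv\pm\{1, 3, 5, 6, 7, 16, 17, 18, 19, 20, 23, 29\}\pmod{60}$. Then $p(S,n)=p(T,n)$ for all integers $n\ge0$ with $n\neq 4$.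
   Context: For a set $S$ of positive integers and an integer $n\ge 0$, $p(S,n)$ denotes the number of partitions of $n$ into parts belonging to $S$ (so $p(S,0)=1$). The notation $S\equiv\pm\{r_1,\dots,r_k\}\pmod M$ means that $S$ is the set of all positive integers $n$ such that $n\equiv r_i$ or $n\equiv -r_i\pmod M$ for some $i$. *)

theory Defs
  imports "HOL-Library.Multiset" "HOL-Number_Theory.Cong"
begin

text \<open>A partition is represented by the multiset of its parts. The set counted by
  \<open>num_partitions S n\<close> is finite whenever \<open>0 \<notin> S\<close>.\<close>

definition num_partitions :: "nat set \<Rightarrow> nat \<Rightarrow> nat" where
  "num_partitions S n = card {P :: nat multiset. set_mset P \<subseteq> S \<and> sum_mset P = n}"

definition pm_residues :: "int set \<Rightarrow> int \<Rightarrow> nat set" where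
  "pm_residues R M = {n. n > 0 \<and> (\<exists>r\<in>R. [int n = r] (mod M) \<or> [int n = - r] (mod M))}"

end

theory Submission
  imports Defs "HOL-Complex_Analysis.Complex_Analysis" "HOL-Real_Asymp.Real_Asymp"
begin

text \<open>
  Put \<open>q = exp (2 \<pi> \<i> \<tau> / 60)\<close>. Each partition generating function is, up to a power of \<open>q\<close>, the
  reciprocal of a product of twelve Siegel functions of level 60, hence a modular function, and each of
  the four identities says that a difference of two of these functions equals 1. Multiplication of
  the residues by 7, 29 and 23 carries (i) to (ii), (iii) and (iv), so the four identities are the
  vanishing of one and the same function \<open>\<Phi>\<close> in conjugate characteristics.

  The product of all conjugates of \<open>\<Phi>\<close> under the modular group is invariant under it and holomorphic in
  the upper half-plane. The poles of the factors at the cusp are known explicitly, and agreement of the first 76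
  coefficients in (i) makes the product vanish there; by the maximum modulus principle it is
  identically zero. Hence one conjugate vanishes identically, and then all of them do.

  The behaviour of the Siegel functions under \<open>\<tau> \<mapsto> -1/\<tau>\<close> follows from Liouville's theorem: the theta
  function and its transform have the same quasi-periods and the same simple zeros.
\<close>

section \<open>Infinite products\<close>

text \<open>The individual functions are invariant only under a congruence subgroup of level 60,
  which has many cusps. Their norm has a single cusp, and there the order of each factor
  \<open>Phi (r, t)\<close> is bounded below in terms of \<open>r\<close> alone. The number 76 comes
  from this count. For each \<open>t\<close>, the characteristics with \<open>r\<close> different
  from 1 and 59 contribute poles of total order at most 150 in \<open>ee (\<tau> / 60)\<close>.
  Those with \<open>r = 1\<close> and \<open>r = 59\<close> contribute the order of vanishing of
  \<open>Phi (1, 0)\<close> once each, because translation turns \<open>(1, 0)\<close> into every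
  \<open>(1, t)\<close> and negation turns these into \<open>(59, t)\<close>. The smallest m with 2
  * m > 150 is 76. Products of exactly twelve factors are convenient because the multiplier of the
  inversion is determined below only up to a twelfth root of unity. In each of the four
  characteristics the vanishing of the defect reads gf(S) - q^d gf(T) = q^e. The monomial q^e is the
  one exceptional coefficient: n = 4 in (iv), and n = 0, outside the stated range, in (i) to
  (iii).\<close>

definition qprod :: "complex \<Rightarrow> complex \<Rightarrow> complex" where
  "qprod a q = (\<Prod>n. 1 - a * q ^ n)"

lemma qprod_convergent:
  fixes a q :: complex
  assumes "norm q < 1"
  shows "convergent_prod (\<lambda>n. 1 - a * q ^ n)"
proof -
  have "summable (\<lambda>n. norm (1 - a * q ^ n - 1))"
    using summable_mult[OF summable_geometric[of "norm q"], of "norm a"] assms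
    by (simp add: norm_mult norm_power)
  thus ?thesis
    by (intro abs_convergent_prod_imp_convergent_prod summable_imp_abs_convergent_prod)
qed

lemma qprod_LIMSEQ:
  assumes "norm q < 1"
  shows "(\<lambda>N. \<Prod>n<N. 1 - a * q ^ n) \<longlonglongrightarrow> qprod a q"
  using convergent_prod_LIMSEQ[OF qprod_convergent[OF assms, of a]]
  unfolding qprod_def by (subst filterlim_sequentially_Suc [symmetric]) (simp add: lessThan_Suc_atMost)

lemma qprod_head:
  assumes "norm q < 1"
  shows "qprod a q = (1 - a) * qprod (a * q) q"
proof -
  have "(\<lambda>N. \<Prod>n<Suc N. 1 - a * q ^ n) \<longlonglongrightarrow> qprod a q"
    by (subst filterlim_sequentially_Suc [where f = "\<lambda>N. \<Prod>n<N. 1 - a * q ^ n"]) (rule qprod_LIMSEQ[OF assms])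
  moreover have "(\<Prod>n<Suc N. 1 - a * q ^ n) = (1 - a) * (\<Prod>n<N. 1 - (a * q) * q ^ n)" for N
    by (subst prod.lessThan_Suc_shift) (simp add: mult.assoc)
  moreover have "(\<lambda>N. (1 - a) * (\<Prod>n<N. 1 - (a * q) * q ^ n)) \<longlonglongrightarrow> (1 - a) * qprod (a * q) q"
    by (intro tendsto_intros qprod_LIMSEQ assms)
  ultimately show ?thesis
    by (auto intro: LIMSEQ_unique)
qed

lemma qprod_nonzero:
  assumes "norm q < 1" "\<And>n. a * q ^ n \<noteq> 1"
  shows "qprod a q \<noteq> 0"
  unfolding qprod_def using assms by (intro prodinf_nonzero qprod_convergent) auto

lemma qprod_eq_0_iff:
  assumes "norm q < 1"
  shows "qprod a q = 0 \<longleftrightarrow> (\<exists>n. a * q ^ n = 1)"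
proof
  assume "\<exists>n. a * q ^ n = 1"
  then obtain n where n: "a * q ^ n = 1" by blast
  have "\<forall>\<^sub>F N in sequentially. (\<Prod>n<N. 1 - a * q ^ n) = 0"
  proof (rule eventually_sequentiallyI[of "Suc n"])
    fix N assume "Suc n \<le> N"
    thus "(\<Prod>n<N. 1 - a * q ^ n) = 0"
      using n by (intro prod_zero) (auto intro!: bexI[of _ n])
  qed
  thus "qprod a q = 0"
    by (intro LIMSEQ_unique[OF qprod_LIMSEQ[OF assms] tendsto_eventually])
qed (use qprod_nonzero[OF assms] in blast)

text \<open>Since 0^0 = 1, only the first factor survives. The leading coefficients at the cusp,
  where the nome is 0, are read off from this value.\<close>

lemma qprod_0_right: "qprod a 0 = 1 - a"
proof -
  have "qprod 0 0 = 1" by (simp add: qprod_def)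
  thus ?thesis using qprod_head[of 0 a] by simp
qed

lemma qprod_mult_minus:
  assumes "norm q < 1"
  shows "qprod a q * qprod (- a) q = qprod (a\<^sup>2) (q\<^sup>2)"
proof -
  have "(1 - a * q ^ n) * (1 - (- a) * q ^ n) = 1 - a\<^sup>2 * (q\<^sup>2) ^ n" for n
    by (simp add: algebra_simps power2_eq_square power_mult_distrib)
  thus ?thesis
    unfolding qprod_def
    by (subst prodinf_mult[OF qprod_convergent[OF assms] qprod_convergent[OF assms]]) simp
qed

lemma qprod_even_odd:
  assumes "norm q < 1"
  shows "qprod a q = qprod a (q\<^sup>2) * qprod (a * q) (q\<^sup>2)"
proof -
  have q2: "norm (q\<^sup>2) < 1"
    using assms by (simp add: norm_power power_less_one_iff)
  have "(\<Prod>n<2*N. 1 - a * q ^ n) = (\<Prod>n<N. 1 - a * (q\<^sup>2) ^ n) * (\<Prod>n<N. 1 - (a * q) * (q\<^sup>2) ^ n)" for N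
  proof (induction N)
    case (Suc N)
    have "q ^ (2 * N) = (q\<^sup>2) ^ N"
      by (rule power_mult)
    thus ?case
      using Suc by (simp add: mult_ac)
  qed simp
  moreover have "(\<lambda>N. \<Prod>n<2*N. 1 - a * q ^ n) \<longlonglongrightarrow> qprod a q"
    using LIMSEQ_subseq_LIMSEQ[OF qprod_LIMSEQ[OF assms], of "\<lambda>N. 2 * N"]
    by (simp add: strict_mono_def o_def)
  moreover have "(\<lambda>N. (\<Prod>n<N. 1 - a * (q\<^sup>2) ^ n) * (\<Prod>n<N. 1 - (a * q) * (q\<^sup>2) ^ n))
      \<longlonglongrightarrow> qprod a (q\<^sup>2) * qprod (a * q) (q\<^sup>2)"
    by (intro tendsto_mult qprod_LIMSEQ q2)
  ultimately show ?thesis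
    by (auto intro: LIMSEQ_unique)
qed

text \<open>On a small closed disc f is bounded by some M and g by some r < 1, so M r^n majorizes
  the terms and the partial products converge uniformly. Both arguments vary at once because the
  nome as well as the first argument will depend on \<tau>.\<close>

lemma holomorphic_qprod:
  assumes A: "open A" and f: "f holomorphic_on A" and g: "g holomorphic_on A"
    and g1: "\<And>x. x \<in> A \<Longrightarrow> norm (g x) < 1"
  shows "(\<lambda>x. qprod (f x) (g x)) holomorphic_on A"
proof (rule holomorphic_uniform_sequence[OF A])
  show "(\<lambda>x. \<Prod>k<n. 1 - f x * g x ^ k) holomorphic_on A" for n
    by (intro holomorphic_intros f g)
next
  fix x assume "x \<in> A"
  then obtain d where d: "d > 0" "cball x d \<subseteq> A"
    using A open_contains_cball by blast
  have cf: "continuous_on (cball x d) f" and cg: "continuous_on (cball x d) g"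
    using f g d holomorphic_on_imp_continuous_on continuous_on_subset by blast+
  have "compact (f ` cball x d)"
    by (intro compact_continuous_image cf) auto
  then obtain M where M: "\<And>y. y \<in> cball x d \<Longrightarrow> norm (f y) \<le> M"
    using compact_imp_bounded bounded_iff by (metis imageI)
  have "\<exists>z\<in>cball x d. \<forall>y\<in>cball x d. norm (g y) \<le> norm (g z)"
    using d by (intro continuous_attains_sup continuous_intros cg) auto
  then obtain z where z: "z \<in> cball x d" "\<And>y. y \<in> cball x d \<Longrightarrow> norm (g y) \<le> norm (g z)"
    by blast
  define r where "r = norm (g z)"
  have r: "0 \<le> r" "r < 1" "\<And>y. y \<in> cball x d \<Longrightarrow> norm (g y) \<le> r"
    using z g1[of z] d unfolding r_def by auto
  have M0: "M \<ge> 0"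
    using M[of x] d by (meson centre_in_cball less_imp_le norm_ge_zero order_trans)
  have "uniformly_convergent_on (cball x d) (\<lambda>N y. \<Sum>n<N. norm (- (f y * g y ^ n)))"
  proof (rule Weierstrass_m_test')
    show "norm (norm (- (f y * g y ^ n))) \<le> M * r ^ n" if "y \<in> cball x d" for y n
      using M[OF that] r(3)[OF that] M0 by (auto simp: norm_mult norm_power intro!: mult_mono power_mono)
    show "summable (\<lambda>n. M * r ^ n)"
      using r by (intro summable_mult summable_geometric) auto
  qed
  hence "uniformly_convergent_on (cball x d) (\<lambda>N y. \<Prod>n<N. 1 + - (f y * g y ^ n))"
    by (intro Infinite_Products.uniformly_convergent_on_prod) (auto intro!: continuous_intros cf cg)
  then obtain l where l: "uniform_limit (cball x d) (\<lambda>N y. \<Prod>n<N. 1 - f y * g y ^ n) l sequentially"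
    by (auto simp: uniformly_convergent_on_def)
  have "l y = qprod (f y) (g y)" if "y \<in> cball x d" for y
    by (rule LIMSEQ_unique[OF tendsto_uniform_limitI[OF l that] qprod_LIMSEQ[OF g1]]) (use d that in blast)
  hence "uniform_limit (cball x d) (\<lambda>N y. \<Prod>n<N. 1 - f y * g y ^ n) (\<lambda>y. qprod (f y) (g y)) sequentially"
    by (intro iffD1[OF uniform_limit_cong' l]) auto
  thus "\<exists>d>0. cball x d \<subseteq> A \<and> uniform_limit (cball x d) (\<lambda>N y. \<Prod>n<N. 1 - f y * g y ^ n)
          (\<lambda>y. qprod (f y) (g y)) sequentially"
    using d by blast
qed

section \<open>The theta function and its inversion\<close>

definition ee :: "complex \<Rightarrow> complex" where
  "ee z = exp (2 * of_real pi * \<i> * z)"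

lemma ee_add: "ee (x + y) = ee x * ee y"
  by (simp add: ee_def ring_distribs exp_add)

lemma ee_0 [simp]: "ee 0 = 1"
  by (simp add: ee_def)

lemma ee_nonzero [simp]: "ee z \<noteq> 0"
  by (simp add: ee_def)

lemma ee_minus: "ee (- z) = 1 / ee z"
  by (simp add: ee_def exp_minus inverse_eq_divide)

lemma ee_diff: "ee (x - y) = ee x / ee y"
  using ee_add[of x "-y"] by (simp add: ee_minus)

lemma ee_power: "ee z ^ n = ee (of_nat n * z)"
  by (simp add: ee_def exp_of_nat_mult [symmetric] mult_ac)

lemma ee_eq_1_iff: "ee z = 1 \<longleftrightarrow> (\<exists>m. z = of_int m)"
proof -
  have "ee z = 1 \<longleftrightarrow> (\<exists>m::int. 2 * of_real pi * \<i> * z = 2 * of_real pi * \<i> * of_int m)"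
    unfolding ee_def exp_eq_1 by (auto simp: complex_eq_iff)
  thus ?thesis by simp
qed

lemma ee_of_int [simp]: "ee (of_int m) = 1"
  by (auto simp: ee_eq_1_iff)

lemma ee_1 [simp]: "ee 1 = 1"
  using ee_of_int[of 1] by simp

lemma ee_half [simp]: "ee (1/2) = -1" "ee (- (1/2)) = -1"
  by (simp_all add: ee_def exp_minus)

lemma norm_ee: "norm (ee z) = exp (- 2 * pi * Im z)"
  by (simp add: ee_def)

lemma norm_ee_less_1: "Im z > 0 \<Longrightarrow> norm (ee z) < 1"
  by (simp add: norm_ee)

lemma holomorphic_ee [holomorphic_intros]:
  "f holomorphic_on A \<Longrightarrow> (\<lambda>z. ee (f z)) holomorphic_on A"
  unfolding ee_def by (intro holomorphic_intros)

text \<open>The product side of the Jacobi triple product identity, without the factor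
  \<open>qprod q q\<close>, which does not depend on \<open>w\<close>.\<close>

definition jac :: "complex \<Rightarrow> complex \<Rightarrow> complex" where
  "jac w q = qprod w q * qprod (q / w) q"

lemma jac_inverse:
  assumes "norm q < 1" "w \<noteq> 0"
  shows "jac (1 / w) q = - jac w q / w"
proof -
  have 1: "jac w q = (1 - w) * qprod (w * q) q * qprod (q / w) q"
    by (simp add: jac_def qprod_head[OF assms(1), of w])
  have "jac (1 / w) q = (1 - 1 / w) * qprod (q / w) q * qprod (w * q) q"
    by (simp add: jac_def qprod_head[OF assms(1), of "1 / w"] mult.commute)
  thus ?thesis
    unfolding 1 using assms by (simp add: field_simps)
qed

lemma jac_shift:
  assumes "norm q < 1" "w \<noteq> 0" "q \<noteq> 0"
  shows "jac (q * w) q = - jac w q / w"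
proof -
  have "jac (q * w) q = jac (1 / w) q"
    using assms by (simp add: jac_def mult.commute)
  thus ?thesis using jac_inverse assms by simp
qed

text \<open>The odd Jacobi theta function of z, up to a nonzero factor depending on \<tau> only;
  dropping that factor is harmless since only quasi-periods and zeros in z matter.\<close>

definition jtheta :: "complex \<Rightarrow> complex \<Rightarrow> complex" where
  "jtheta z \<tau> = ee (- z / 2) * jac (ee z) (ee \<tau>)"

lemma jtheta_plus_1: "jtheta (z + 1) \<tau> = - jtheta z \<tau>"
proof -
  have "ee (- (z + 1) / 2) = ee (- z / 2) * ee (- (1/2))"
    by (subst ee_add [symmetric]) (simp add: field_simps)
  thus ?thesis by (simp add: jtheta_def ee_add)
qed

lemma jtheta_plus_tau:
  assumes "Im \<tau> > 0"
  shows "jtheta (z + \<tau>) \<tau> = - ee (- z - \<tau> / 2) * jtheta z \<tau>"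
proof -
  have "ee (- (z + \<tau>) / 2) / ee z = ee (- z - \<tau> / 2) * ee (- z / 2)"
    unfolding ee_add [symmetric] ee_diff [symmetric] by (rule arg_cong[of _ _ ee]) (simp add: field_simps)
  hence eq: "- (ee (- (z + \<tau>) / 2) / ee z) * J = - ee (- z - \<tau> / 2) * (ee (- z / 2) * J)" for J
    by simp
  have "jtheta (z + \<tau>) \<tau> = ee (- (z + \<tau>) / 2) * jac (ee \<tau> * ee z) (ee \<tau>)"
    by (simp add: jtheta_def ee_add mult.commute)
  also have "\<dots> = - (ee (- (z + \<tau>) / 2) / ee z) * jac (ee z) (ee \<tau>)"
    by (subst jac_shift) (simp_all add: norm_ee_less_1[OF assms])
  finally show ?thesis
    unfolding eq jtheta_def .
qed

text \<open>With w = \<open>ee z\<close> and q = \<open>ee \<tau>\<close>, the first product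
  vanishes at w = q^(-n) and the second at w = q^(n + 1) for n \<ge> 0, so together they account for
  every integer power of q.\<close>

lemma jtheta_eq_0_iff:
  assumes "Im \<tau> > 0"
  shows "jtheta z \<tau> = 0 \<longleftrightarrow> (\<exists>m n::int. z = of_int m + of_int n * \<tau>)"
proof -
  have 1: "ee z * ee \<tau> ^ n = 1 \<longleftrightarrow> (\<exists>m::int. z = of_int m + of_int (- int n) * \<tau>)" for n
    unfolding ee_power ee_add [symmetric] ee_eq_1_iff by (auto simp: algebra_simps)
  have 2: "ee \<tau> / ee z * ee \<tau> ^ n = 1 \<longleftrightarrow> (\<exists>m::int. z = of_int m + of_int (1 + int n) * \<tau>)" for n
  proof -
    have "ee \<tau> / ee z * ee \<tau> ^ n = 1 \<longleftrightarrow> (\<exists>m::int. \<tau> - z + of_nat n * \<tau> = of_int m)"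
      unfolding ee_power ee_add [symmetric] ee_diff [symmetric] ee_eq_1_iff ..
    also have "\<dots> \<longleftrightarrow> (\<exists>m::int. z = of_int (- m) + of_int (1 + int n) * \<tau>)"
      by (intro ex_cong1) (auto simp: algebra_simps)
    also have "\<dots> \<longleftrightarrow> (\<exists>m::int. z = of_int m + of_int (1 + int n) * \<tau>)"
      by (metis minus_minus)
    finally show ?thesis .
  qed
  have "jtheta z \<tau> = 0 \<longleftrightarrow> (\<exists>n. ee z * ee \<tau> ^ n = 1) \<or> (\<exists>n. ee \<tau> / ee z * ee \<tau> ^ n = 1)"
    using qprod_eq_0_iff[OF norm_ee_less_1[OF assms]] by (simp add: jtheta_def jac_def)
  also have "\<dots> \<longleftrightarrow> (\<exists>m n::int. z = of_int m + of_int n * \<tau>)"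
  proof
    assume "\<exists>m n::int. z = of_int m + of_int n * \<tau>"
    then obtain m n :: int where z: "z = of_int m + of_int n * \<tau>" by blast
    show "(\<exists>n. ee z * ee \<tau> ^ n = 1) \<or> (\<exists>n. ee \<tau> / ee z * ee \<tau> ^ n = 1)"
    proof (cases "n \<le> 0")
      case True
      hence "z = of_int m + of_int (- int (nat (- n))) * \<tau>" using z by simp
      thus ?thesis using 1 by blast
    next
      case False
      hence "z = of_int m + of_int (1 + int (nat (n - 1))) * \<tau>" using z by simp
      thus ?thesis using 2 by blast
    qed
  qed (use 1 2 in blast)
  finally show ?thesis .
qed

lemma holomorphic_jac:
  assumes "open A" "f holomorphic_on A" "g holomorphic_on A"
    "\<And>x. x \<in> A \<Longrightarrow> norm (g x) < 1" "\<And>x. x \<in> A \<Longrightarrow> f x \<noteq> 0"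
  shows "(\<lambda>x. jac (f x) (g x)) holomorphic_on A"
  unfolding jac_def using assms by (intro holomorphic_intros holomorphic_qprod) auto

lemma holomorphic_jtheta:
  assumes "Im \<tau> > 0"
  shows "(\<lambda>z. jtheta z \<tau>) holomorphic_on UNIV"
  unfolding jtheta_def using norm_ee_less_1[OF assms]
  by (intro holomorphic_intros holomorphic_jac) auto

text \<open>Splitting off the factor \<open>1 - ee z\<close>, which has a simple zero at 0, leaves a
  cofactor \<open>V\<close> that does not vanish there. Simplicity of the other zeros follows by
  quasi-periodicity.\<close>

lemma jtheta_deriv_0_nonzero:
  assumes "Im \<tau> > 0"
  shows "deriv (\<lambda>z. jtheta z \<tau>) 0 \<noteq> 0"
proof -
  note q = norm_ee_less_1[OF assms]
  define V where "V = (\<lambda>z. ee (- z / 2) * (qprod (ee z * ee \<tau>) (ee \<tau>) * qprod (ee \<tau> / ee z) (ee \<tau>)))"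
  have "V holomorphic_on UNIV"
    unfolding V_def using q by (intro holomorphic_intros holomorphic_qprod) auto
  hence V: "(V has_field_derivative deriv V 0) (at 0)"
    by (simp add: holomorphic_derivI)
  have V0: "V 0 \<noteq> 0"
  proof -
    have "norm (ee \<tau> * ee \<tau> ^ n) < 1" for n
      using q norm_ee_less_1 assms by (simp add: ee_power ee_add [symmetric] add_pos_nonneg)
    hence "ee \<tau> * ee \<tau> ^ n \<noteq> 1" for n
      by (metis less_irrefl norm_one)
    thus ?thesis using qprod_nonzero[OF q] by (simp add: V_def)
  qed
  have eq: "(\<lambda>z. jtheta z \<tau>) = (\<lambda>z. (1 - ee z) * V z)"
    using qprod_head[OF q, of "ee _"] by (intro ext) (simp add: jtheta_def jac_def V_def)
  have "((\<lambda>z. 1 - ee z) has_field_derivative - (2 * of_real pi * \<i>)) (at 0)"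
    unfolding ee_def by (auto intro!: derivative_eq_intros)
  from DERIV_mult[OF this V] have "((\<lambda>z. (1 - ee z) * V z) has_field_derivative
          - (2 * of_real pi * \<i>) * V 0 + deriv V 0 * (1 - ee 0)) (at 0)" .
  hence "deriv (\<lambda>z. jtheta z \<tau>) 0 = - (2 * of_real pi * \<i>) * V 0"
    unfolding eq by (simp add: DERIV_imp_deriv)
  thus ?thesis using V0 by simp
qed

lemma divided_by_z_holomorphic:
  assumes "f holomorphic_on UNIV" "f 0 = 0"
  shows "(\<lambda>z::complex. if z = 0 then deriv f 0 else f z / z) holomorphic_on UNIV"
  by (rule pole_theorem_open_0[of f _ 0]) (use assms in auto)

text \<open>The quotient of two functions with the same quasi-periods is elliptic, and it has no
  poles because the denominator only has simple zeros, at the lattice points.\<close>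

lemma quasi_periodic_eq_jtheta:
  assumes \<tau>: "Im \<tau> > 0" and R: "R holomorphic_on UNIV" and R0: "R 0 = 0"
    and R1: "\<And>z. R (z + 1) = - R z"
    and Rtau: "\<And>z. R (z + \<tau>) = - ee (- z - \<tau> / 2) * R z"
  shows "\<exists>C. \<forall>z. R z = C * jtheta z \<tau>"
proof -
  define \<theta> where "\<theta> = (\<lambda>z. jtheta z \<tau>)"
  have \<theta>: "\<theta> holomorphic_on UNIV" and \<theta>'0: "deriv \<theta> 0 \<noteq> 0"
    using holomorphic_jtheta[OF \<tau>] jtheta_deriv_0_nonzero[OF \<tau>] by (auto simp: \<theta>_def)
  have \<theta>0: "\<theta> 0 = 0"
    unfolding \<theta>_def jtheta_eq_0_iff[OF \<tau>] by (intro exI[of _ 0]) auto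
  define \<theta>1 where "\<theta>1 = (\<lambda>z. if z = 0 then deriv \<theta> 0 else \<theta> z / z)"
  define S1 where "S1 = (\<lambda>z. if z = 0 then deriv R 0 else R z / z)"
  have hol1: "\<theta>1 holomorphic_on UNIV" "S1 holomorphic_on UNIV"
    unfolding \<theta>1_def S1_def using \<theta> \<theta>0 R R0 by (auto intro!: divided_by_z_holomorphic)
  have "isCont \<theta>1 0"
    using hol1(1) holomorphic_on_imp_continuous_on continuous_on_eq_continuous_at by blast
  moreover have "\<theta>1 0 \<noteq> 0" using \<theta>'0 by (simp add: \<theta>1_def)
  ultimately obtain r where r: "r > 0" "\<And>z. z \<in> ball 0 r \<Longrightarrow> \<theta>1 z \<noteq> 0"
    using continuous_at_avoid[of 0 \<theta>1 0] by (auto simp: dist_commute)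
  \<comment> \<open>The default is the removable value at 0. It serves at every lattice point,
    because \<open>h\<close> is periodic and all zeros of \<theta> are lattice points.\<close>
  define h where "h = (\<lambda>z. if \<theta> z = 0 then deriv R 0 / deriv \<theta> 0 else R z / \<theta> z)"
  have h_ball: "h z = S1 z / \<theta>1 z" if "z \<in> ball 0 r" for z
    using r(2)[OF that] \<theta>0 by (auto simp: h_def S1_def \<theta>1_def)
  have "(\<lambda>z. S1 z / \<theta>1 z) holomorphic_on ball 0 r"
    using r hol1 by (intro holomorphic_on_divide) (auto intro: holomorphic_on_subset)
  hence h_hol_ball: "h holomorphic_on ball 0 r"
    by (rule holomorphic_transform) (use h_ball in simp)
  have h1: "h (z + 1) = h z" for z
    using R1[of z] jtheta_plus_1[of z \<tau>] by (simp add: h_def \<theta>_def)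
  have htau: "h (z + \<tau>) = h z" for z
    using Rtau[of z] jtheta_plus_tau[OF \<tau>, of z] by (simp add: h_def \<theta>_def)
  have h1n: "h (z + of_nat n) = h z" for z n
    by (induction n) (use h1[of "z + of_nat _"] in \<open>auto simp: algebra_simps\<close>)
  have htaun: "h (z + of_nat n * \<tau>) = h z" for z n
    by (induction n) (use htau[of "z + of_nat _ * \<tau>"] in \<open>auto simp: algebra_simps\<close>)
  have h1i: "h (z + of_int m) = h z" for z m
  proof (cases "m \<ge> 0")
    case True thus ?thesis using h1n[of z "nat m"] by simp
  next
    case False thus ?thesis using h1n[of "z + of_int m" "nat (-m)"] by simp
  qed
  have htaui: "h (z + of_int m * \<tau>) = h z" for z m
  proof (cases "m \<ge> 0")
    case True thus ?thesis using htaun[of z "nat m"] by simp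
  next
    case False thus ?thesis using htaun[of "z + of_int m * \<tau>" "nat (-m)"] by simp
  qed
  have h_lattice: "h (z + (of_int m + of_int n * \<tau>)) = h z" for z m n
    using h1i[of z m] htaui[of "z + of_int m" n] by (simp add: add.assoc)
  have "h field_differentiable at w" for w
  proof (cases "\<theta> w = 0")
    case True
    then obtain m n where w: "w = of_int m + of_int n * \<tau>"
      using jtheta_eq_0_iff[OF \<tau>] unfolding \<theta>_def by blast
    have "h field_differentiable at 0"
      using h_hol_ball r(1) by (metis centre_in_ball holomorphic_on_imp_differentiable_at open_ball)
    hence "h field_differentiable at (w - w)" by simp
    hence "(h \<circ> (\<lambda>z. z - w)) field_differentiable at w"
      by (intro field_differentiable_compose) (auto intro!: derivative_intros field_differentiable_diff)
    moreover have "h \<circ> (\<lambda>z. z - w) = h"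
      using h_lattice[of "_ - w" m n] w by (auto simp: fun_eq_iff)
    ultimately show ?thesis by simp
  next
    case False
    define A where "A = {z. \<theta> z \<noteq> 0}"
    have "continuous_on UNIV \<theta>"
      using \<theta> holomorphic_on_imp_continuous_on by blast
    hence A: "open A"
      unfolding A_def by (intro open_Collect_neq continuous_intros)
    have "(\<lambda>z. R z / \<theta> z) holomorphic_on A"
      using R \<theta> by (intro holomorphic_on_divide) (auto intro: holomorphic_on_subset simp: A_def)
    hence "h holomorphic_on A"
      by (rule holomorphic_transform) (auto simp: A_def h_def)
    thus ?thesis
      using A False by (auto simp: A_def intro: holomorphic_on_imp_differentiable_at)
  qed
  hence h_hol: "h holomorphic_on UNIV"
    by (simp add: holomorphic_on_def)
  define K where "K = (\<lambda>(x, y). complex_of_real x + of_real y * \<tau>) ` ({0..1} \<times> {0..1})"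
  have "compact K"
    unfolding K_def by (intro compact_continuous_image compact_Times)
      (auto simp: case_prod_unfold intro!: continuous_intros)
  hence "bounded (h ` K)"
    using h_hol by (intro compact_imp_bounded compact_continuous_image)
      (auto intro: continuous_on_subset holomorphic_on_imp_continuous_on)
  moreover have "range h \<subseteq> h ` K"
  proof safe
    fix z
    define y where "y = Im z / Im \<tau>"
    define x where "x = Re z - y * Re \<tau>"
    have z: "z = of_real x + of_real y * \<tau>"
      using \<tau> by (simp add: complex_eq_iff x_def y_def)
    define k where "k = complex_of_real (frac x) + of_real (frac y) * \<tau>"
    have "z = k + (of_int \<lfloor>x\<rfloor> + of_int \<lfloor>y\<rfloor> * \<tau>)"
      by (simp add: z k_def frac_def algebra_simps)
    hence "h z = h k" using h_lattice by simp
    moreover have "k \<in> K"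
      unfolding K_def k_def by (rule image_eqI[of _ _ "(frac x, frac y)"]) (auto simp: frac_lt_1 less_imp_le)
    ultimately show "h z \<in> h ` K" by auto
  qed
  ultimately have "bounded (range h)" using bounded_subset by blast
  then obtain C where C: "\<And>z. h z = C"
    using Liouville_theorem[OF h_hol] by (auto simp: constant_on_def)
  \<comment> \<open>At the zeros of \<theta> constancy of \<open>h\<close> says nothing about
    \<open>R\<close>, so the equation is proved on a punctured disc and then continued
    analytically.\<close>
  have "R z = C * \<theta> z" for z
  proof (rule analytic_continuation_open[of "ball 0 r - {0}" UNIV R "\<lambda>z. C * \<theta> z"])
    show "ball 0 r - {0::complex} \<noteq> {}"
      using r(1) by (auto simp: set_eq_iff intro!: exI[of _ "complex_of_real (r / 2)"])
    show "R z = C * \<theta> z" if "z \<in> ball 0 r - {0}" for z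
      using C[of z] h_ball[of z] r(2)[of z] that by (auto simp: S1_def \<theta>1_def field_simps split: if_splits)
  qed (use R \<theta> in \<open>auto intro!: holomorphic_intros open_delete\<close>)
  thus ?thesis unfolding \<theta>_def by blast
qed

lemma Im_inversion: "Im (- 1 / \<tau>) = Im \<tau> / (norm \<tau>)\<^sup>2"
  by (simp add: Im_divide cmod_power2)

lemma upper_inversion: "Im \<tau> > 0 \<Longrightarrow> Im (- 1 / \<tau>) > 0"
  unfolding Im_inversion by (auto simp: zero_less_divide_iff)

text \<open>The Gaussian factor in \<open>R\<close> turns the quasi-periods of the transform into
  those of \<open>jtheta z \<tau>\<close>. The two periods exchange roles: z + 1 uses the
  quasi-period -1/\<tau> of the transform, and z + \<tau> uses its period 1.\<close>

lemma jtheta_inversion: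
  assumes \<tau>: "Im \<tau> > 0"
  shows "\<exists>C. \<forall>z. jtheta (z / \<tau>) (- 1 / \<tau>) = C * ee (z\<^sup>2 / (2 * \<tau>)) * jtheta z \<tau>"
proof -
  define R where "R = (\<lambda>z. jtheta (z / \<tau>) (- 1 / \<tau>) * ee (- z\<^sup>2 / (2 * \<tau>)))"
  have [simp]: "\<tau> \<noteq> 0" using \<tau> by auto
  note \<tau>' = upper_inversion[OF \<tau>]
  have "\<exists>C. \<forall>z. R z = C * jtheta z \<tau>"
  proof (rule quasi_periodic_eq_jtheta[OF \<tau>])
    have "(\<lambda>z. jtheta z (- 1 / \<tau>)) \<circ> (\<lambda>z. z / \<tau>) holomorphic_on UNIV"
      by (intro holomorphic_on_compose holomorphic_on_subset[OF holomorphic_jtheta[OF \<tau>'] subset_UNIV]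
          holomorphic_intros) auto
    thus "R holomorphic_on UNIV"
      unfolding R_def o_def by (intro holomorphic_intros) auto
    show "R 0 = 0"
      unfolding R_def using jtheta_eq_0_iff[OF \<tau>', of 0] by (auto intro: exI[of _ "0::int"])
    fix z
    have "jtheta (z / \<tau>) (- 1 / \<tau>) = - ee (- ((z + 1) / \<tau>) - (- 1 / \<tau>) / 2) * jtheta ((z + 1) / \<tau>) (- 1 / \<tau>)"
      using jtheta_plus_tau[OF \<tau>', of "(z + 1) / \<tau>"] by (simp add: add_divide_distrib)
    hence "jtheta (z / \<tau>) (- 1 / \<tau>) * ee (- z\<^sup>2 / (2 * \<tau>)) =
      - (ee (- ((z + 1) / \<tau>) - (- 1 / \<tau>) / 2) * ee (- z\<^sup>2 / (2 * \<tau>))) * jtheta ((z + 1) / \<tau>) (- 1 / \<tau>)"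
      by simp
    also have "ee (- ((z + 1) / \<tau>) - (- 1 / \<tau>) / 2) * ee (- z\<^sup>2 / (2 * \<tau>)) = ee (- (z + 1)\<^sup>2 / (2 * \<tau>))"
      unfolding ee_add [symmetric] by (rule arg_cong[of _ _ ee]) (simp add: field_simps power2_eq_square)
    finally show "R (z + 1) = - R z"
      by (simp add: R_def)
    have "ee (- (z + \<tau>)\<^sup>2 / (2 * \<tau>)) = ee (- z - \<tau> / 2) * ee (- z\<^sup>2 / (2 * \<tau>))"
      unfolding ee_add [symmetric] by (rule arg_cong[of _ _ ee]) (simp add: field_simps power2_eq_square)
    thus "R (z + \<tau>) = - ee (- z - \<tau> / 2) * R z"
      using jtheta_plus_1[of "z / \<tau>" "- 1 / \<tau>"] by (simp add: R_def add_divide_distrib)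
  qed
  then obtain C where C: "R z = C * jtheta z \<tau>" for z by blast
  have "jtheta (z / \<tau>) (- 1 / \<tau>) = C * ee (z\<^sup>2 / (2 * \<tau>)) * jtheta z \<tau>" for z
    using C[of z] by (simp add: R_def ee_minus field_simps)
  thus ?thesis by blast
qed

section \<open>Siegel functions\<close>

text \<open>Minus the classical Siegel function without its factor \<open>ee (\<tau> / 12)\<close>:
  the leading exponent is a(a - 1)/2 instead of (a^2 - a + 1/6)/2. \<open>siegprod\<close> restores
  twelve such factors at once by \<open>ee \<tau>\<close>.\<close>

definition sieg :: "complex \<Rightarrow> complex \<Rightarrow> complex \<Rightarrow> complex" where
  "sieg a b \<tau> = ee ((a - 1) * (a * \<tau> + b) / 2) * jac (ee (a * \<tau> + b)) (ee \<tau>)"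

lemma sieg_conv_jtheta: "sieg a b \<tau> = ee (a * (a * \<tau> + b) / 2) * jtheta (a * \<tau> + b) \<tau>"
proof -
  have "ee ((a - 1) * (a * \<tau> + b) / 2) = ee (a * (a * \<tau> + b) / 2) * ee (- (a * \<tau> + b) / 2)"
    unfolding ee_add [symmetric] by (rule arg_cong[of _ _ ee]) (simp add: field_simps)
  thus ?thesis by (simp add: sieg_def jtheta_def)
qed

lemma sieg_shift1:
  assumes "Im \<tau> > 0"
  shows "sieg (a + 1) b \<tau> = - ee (- b / 2) * sieg a b \<tau>"
proof -
  define z where "z = a * \<tau> + b"
  have z: "(a + 1) * \<tau> + b = z + \<tau>" by (simp add: z_def algebra_simps)
  have "ee ((a + 1) * (z + \<tau>) / 2) * ee (- z - \<tau> / 2) = ee (- b / 2) * ee (a * z / 2)"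
    unfolding ee_add [symmetric] by (rule arg_cong[of _ _ ee]) (simp add: z_def field_simps)
  hence eq: "- (ee ((a + 1) * (z + \<tau>) / 2) * ee (- z - \<tau> / 2)) * t = - ee (- b / 2) * (ee (a * z / 2) * t)" for t
    by simp
  show ?thesis
    unfolding sieg_conv_jtheta z z_def [symmetric] jtheta_plus_tau[OF assms] using eq[of "jtheta z \<tau>"]
    by simp
qed

lemma sieg_shift2: "sieg a (b + 1) \<tau> = - ee (a / 2) * sieg a b \<tau>"
proof -
  define z where "z = a * \<tau> + b"
  have z: "a * \<tau> + (b + 1) = z + 1" by (simp add: z_def algebra_simps)
  have "ee (a * (z + 1) / 2) = ee (a / 2) * ee (a * z / 2)"
    unfolding ee_add [symmetric] by (rule arg_cong[of _ _ ee]) (simp add: field_simps)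
  thus ?thesis
    unfolding sieg_conv_jtheta z z_def [symmetric] jtheta_plus_1 by simp
qed

lemma sieg_uminus:
  assumes "Im \<tau> > 0"
  shows "sieg (- a) (- b) \<tau> = - sieg a b \<tau>"
proof -
  define z where "z = a * \<tau> + b"
  have z: "- a * \<tau> + - b = - z" by (simp add: z_def)
  have eq: "ee ((- a - 1) * (- z) / 2) / ee z = ee ((a - 1) * z / 2)"
    unfolding ee_diff [symmetric] by (rule arg_cong[of _ _ ee]) (simp add: field_simps)
  have "sieg (- a) (- b) \<tau> = ee ((- a - 1) * (- z) / 2) * jac (1 / ee z) (ee \<tau>)"
    unfolding sieg_def z ee_minus[of z] ..
  also have "\<dots> = - (ee ((- a - 1) * (- z) / 2) / ee z) * jac (ee z) (ee \<tau>)"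
    by (subst jac_inverse) (simp_all add: norm_ee_less_1[OF assms])
  finally show ?thesis
    unfolding eq by (simp add: sieg_def z_def)
qed

lemma sieg_plus_1: "sieg a b (\<tau> + 1) = sieg a (a + b) \<tau>"
  by (simp add: sieg_def algebra_simps ee_add)

text \<open>With q = s^2 the first two factors combine to the product of 1 - q^n over odd n, and the
  third is the product of 1 + q^n over all n \<ge> 1. This is Euler's identity behind partitions
  into odd and into distinct parts.\<close>

lemma qprod_euler:
  assumes "norm s < 1"
  shows "qprod s (s\<^sup>2) * qprod (- s) (s\<^sup>2) * qprod (- s\<^sup>2) (s\<^sup>2) = 1"
proof -
  define q where "q = s\<^sup>2"
  have q: "norm q < 1"
    using assms by (simp add: q_def norm_power power_less_one_iff)
  have "qprod q q \<noteq> 0"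
  proof (rule qprod_nonzero[OF q])
    fix n
    have "norm (q ^ Suc n) < 1"
      using q by (simp add: norm_power norm_mult power_less_one_iff del: power_Suc)
    thus "q * q ^ n \<noteq> 1" by (metis less_irrefl norm_one power_Suc)
  qed
  moreover have "qprod s q * qprod (- s) q = qprod q (q\<^sup>2)"
    using qprod_mult_minus[OF q, of s] by (simp add: q_def)
  moreover have "qprod q q * qprod (- q) q = qprod (q\<^sup>2) (q\<^sup>2)"
    using qprod_mult_minus[OF q, of q] .
  moreover have "qprod q q = qprod q (q\<^sup>2) * qprod (q\<^sup>2) (q\<^sup>2)"
    using qprod_even_odd[OF q, of q] by (simp add: power2_eq_square)
  ultimately show ?thesis
    unfolding q_def [symmetric] by (metis mult.assoc mult.commute mult_cancel_left1 mult.right_neutral)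
qed

text \<open>Up to elementary factors the three terms are the squares of Weber's functions, whose
  product is constant by Euler's identity.\<close>

lemma sieg_half_points:
  assumes "Im \<tau> > 0"
  shows "sieg (1/2) 0 \<tau> * sieg 0 (1/2) \<tau> * sieg (1/2) (1/2) \<tau> = 2 * ee (- 3 / 8) * ee (- \<tau> / 4)"
proof -
  define s where "s = ee (\<tau> / 2)"
  have q: "ee \<tau> = s\<^sup>2"
    by (simp add: s_def power2_eq_square ee_add [symmetric])
  have s: "norm s < 1" "s \<noteq> 0"
    using assms by (auto simp: s_def norm_ee_less_1)
  have q1: "norm (s\<^sup>2) < 1"
    using s by (simp add: norm_power power_less_one_iff)
  have s': "ee (\<tau> / 2 + 1 / 2) = - s"
    by (simp add: ee_add s_def)
  define c where "c = ee ((1 / 2 - 1) * (\<tau> / 2) / 2) * ee ((0 - 1) * (1 / 2) / 2) * ee ((1 / 2 - 1) * (\<tau> / 2 + 1 / 2) / 2)"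
  have "sieg (1/2) 0 \<tau> * sieg 0 (1/2) \<tau> * sieg (1/2) (1/2) \<tau> =
      c * (jac s (s\<^sup>2) * jac (-1) (s\<^sup>2) * jac (- s) (s\<^sup>2))"
    by (simp add: sieg_def c_def q s' s_def [symmetric])
  also have "jac s (s\<^sup>2) = qprod s (s\<^sup>2) ^ 2"
    using s by (simp add: jac_def power2_eq_square)
  also have "jac (- s) (s\<^sup>2) = qprod (- s) (s\<^sup>2) ^ 2"
    using s by (simp add: jac_def power2_eq_square)
  also have "jac (- 1) (s\<^sup>2) = 2 * qprod (- s\<^sup>2) (s\<^sup>2) ^ 2"
    using qprod_head[OF q1, of "-1"] by (simp add: jac_def power2_eq_square)
  also have "qprod s (s\<^sup>2) ^ 2 * (2 * qprod (- s\<^sup>2) (s\<^sup>2) ^ 2) * qprod (- s) (s\<^sup>2) ^ 2 =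
      2 * (qprod s (s\<^sup>2) * qprod (- s) (s\<^sup>2) * qprod (- s\<^sup>2) (s\<^sup>2)) ^ 2"
    by (simp add: power_mult_distrib)
  also have "\<dots> = 2"
    using qprod_euler[OF s(1)] by simp
  also have "c = ee (- 3 / 8) * ee (- \<tau> / 4)"
    unfolding c_def ee_add [symmetric] by (rule arg_cong[of _ _ ee]) (simp add: field_simps)
  finally show ?thesis by simp
qed

text \<open>The multiplier of the inversion is the same for all characteristics; its twelfth power is
  read off from the three half-period characteristics, which the inversion permutes and whose
  product is elementary.\<close>

lemma sieg_inversion:
  assumes \<tau>: "Im \<tau> > 0"
  obtains C where "\<And>a b. sieg a b (- 1 / \<tau>) = C * sieg b (- a) \<tau>" "C ^ 12 = ee (\<tau> + 1 / \<tau>)"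
proof -
  have [simp]: "\<tau> \<noteq> 0" using \<tau> by auto
  note \<tau>' = upper_inversion[OF \<tau>]
  obtain C where C: "jtheta (z / \<tau>) (- 1 / \<tau>) = C * ee (z\<^sup>2 / (2 * \<tau>)) * jtheta z \<tau>" for z
    using jtheta_inversion[OF \<tau>] by blast
  have S: "sieg a b (- 1 / \<tau>) = C * sieg b (- a) \<tau>" for a b
  proof -
    define z where "z = b * \<tau> + - a"
    have z: "a * (- 1 / \<tau>) + b = z / \<tau>" by (simp add: z_def field_simps)
    have "ee (a * (z / \<tau>) / 2) * ee (z\<^sup>2 / (2 * \<tau>)) = ee (b * z / 2)"
      unfolding ee_add [symmetric] by (rule arg_cong[of _ _ ee]) (simp add: z_def field_simps power2_eq_square)
    hence "ee (a * (z / \<tau>) / 2) * (C * ee (z\<^sup>2 / (2 * \<tau>)) * t) = C * (ee (b * z / 2) * t)" for t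
      by simp
    thus ?thesis
      unfolding sieg_conv_jtheta z z_def [symmetric] C by simp
  qed
  \<comment> \<open>The inversion sends two of the half-period characteristics to ones with second
    entry -1/2; a shift by 1 brings them back to the original three.\<close>
  have h1: "sieg 0 (1/2) \<tau> = - sieg 0 (- (1/2)) \<tau>"
    using sieg_shift2[of 0 "- (1/2)" \<tau>] by simp
  have h2: "sieg (1/2) (1/2) \<tau> = - ee (1/4) * sieg (1/2) (- (1/2)) \<tau>"
    using sieg_shift2[of "1/2" "- (1/2)" \<tau>] by simp
  have "2 * ee (- 3 / 8) * ee (1 / (4 * \<tau>)) * ee (1/4) = C ^ 3 * (2 * ee (- 3 / 8) * ee (- \<tau> / 4))"
  proof -
    have "2 * ee (- 3 / 8) * ee (- (- 1 / \<tau>) / 4) =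
        (C * sieg 0 (- (1/2)) \<tau>) * (C * sieg (1/2) 0 \<tau>) * (C * sieg (1/2) (- (1/2)) \<tau>)"
      unfolding sieg_half_points[OF \<tau>', symmetric] S by simp
    hence "2 * ee (- 3 / 8) * ee (- (- 1 / \<tau>) / 4) * ee (1/4) =
        C ^ 3 * (sieg (1/2) 0 \<tau> * sieg 0 (1/2) \<tau> * sieg (1/2) (1/2) \<tau>)"
      unfolding h1 h2 by (simp add: power3_eq_cube)
    moreover have "- (- 1 / \<tau>) / 4 = 1 / (4 * \<tau>)" by simp
    ultimately show ?thesis unfolding sieg_half_points[OF \<tau>] by (simp only:)
  qed
  hence "2 * ee (- 3 / 8) * (ee (1 / (4 * \<tau>)) * ee (1/4)) = 2 * ee (- 3 / 8) * (C ^ 3 * ee (- \<tau> / 4))"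
    by (simp only: mult_ac)
  hence "ee (1 / (4 * \<tau>)) * ee (1/4) = C ^ 3 * ee (- \<tau> / 4)"
    by simp
  hence "C ^ 3 = ee (1 / (4 * \<tau>)) * ee (1/4) / ee (- \<tau> / 4)"
    by simp
  also have "\<dots> = ee ((\<tau> + 1 / \<tau> + 1) / 4)"
    unfolding ee_add [symmetric] ee_diff [symmetric] by (rule arg_cong[of _ _ ee]) (simp add: field_simps)
  \<comment> \<open>The fourth power turns the leftover root of unity \<open>ee (1/4)\<close> into
    1.\<close>
  finally have "C ^ (3 * 4) = ee ((\<tau> + 1 / \<tau> + 1) / 4) ^ 4"
    by (simp only: power_mult)
  also have "\<dots> = ee (\<tau> + 1 / \<tau> + 1)"
    unfolding ee_power by (rule arg_cong[of _ _ ee]) simp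
  also have "\<dots> = ee (\<tau> + 1 / \<tau>)"
    by (simp add: ee_add)
  finally have "C ^ 12 = ee (\<tau> + 1 / \<tau>)" by simp
  with S show ?thesis by (rule that)
qed

section \<open>A vanishing criterion for modular functions\<close>

abbreviation upper :: "complex set" where
  "upper \<equiv> {\<tau>. Im \<tau> > 0}"

lemma open_upper: "open upper"
  by (rule open_halfspace_Im_gt)

lemma connected_upper: "connected upper"
  by (intro convex_connected convex_halfspace_Im_gt)

text \<open>Inverting a point with small imaginary part and real part in \<open>[-1/2, 1/2]\<close> at least doubles
  the imaginary part, so finitely many translations and inversions reach \<open>Im \<tau> \<ge> 1/2\<close>.\<close>

lemma upper_reduction:
  fixes F :: "complex \<Rightarrow> complex"
  assumes T: "\<And>\<tau>. Im \<tau> > 0 \<Longrightarrow> F (\<tau> + 1) = F \<tau>"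
    and S: "\<And>\<tau>. Im \<tau> > 0 \<Longrightarrow> F (- 1 / \<tau>) = F \<tau>" and \<tau>: "Im \<tau> > 0"
  shows "\<exists>\<tau>'. Im \<tau>' \<ge> 1/2 \<and> \<bar>Re \<tau>'\<bar> \<le> 1/2 \<and> F \<tau>' = F \<tau>"
proof -
  have Tn: "F (\<tau> + of_nat n) = F \<tau>" if "Im \<tau> > 0" for \<tau> n
    by (induction n) (use T[of "\<tau> + of_nat _"] that in \<open>auto simp: add_ac\<close>)
  have Ti: "F (\<tau> + of_int n) = F \<tau>" if "Im \<tau> > 0" for \<tau> n
  proof (cases "n \<ge> 0")
    case True thus ?thesis using Tn[OF that, of "nat n"] by simp
  next
    case False thus ?thesis using Tn[of "\<tau> + of_int n" "nat (-n)"] that by simp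
  qed
  obtain n where "(1/2) / Im \<tau> < 2 ^ n"
    using real_arch_pow[of 2 "(1/2) / Im \<tau>"] by auto
  hence "Im \<tau> \<ge> (1/2) / 2 ^ n"
    using \<tau> by (simp add: field_simps)
  thus ?thesis using \<tau>
  proof (induction n arbitrary: \<tau>)
    case (0 \<tau>)
    show ?case
      using 0 Ti[of \<tau> "- round (Re \<tau>)"] of_int_round_abs_le[of "Re \<tau>"]
      by (intro exI[of _ "\<tau> + of_int (- round (Re \<tau>))"]) (auto simp: abs_minus_commute)
  next
    case (Suc n \<tau>)
    define \<sigma> where "\<sigma> = \<tau> + of_int (- round (Re \<tau>))"
    have \<sigma>: "Im \<sigma> = Im \<tau>" "\<bar>Re \<sigma>\<bar> \<le> 1/2" "F \<sigma> = F \<tau>"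
      using Suc.prems Ti[of \<tau> "- round (Re \<tau>)"] of_int_round_abs_le[of "Re \<tau>"]
      by (auto simp: \<sigma>_def abs_minus_commute)
    show ?case
    proof (cases "Im \<tau> \<ge> 1/2")
      case True
      thus ?thesis using \<sigma> by (intro exI[of _ \<sigma>]) auto
    next
      case False
      have "(Re \<sigma>)\<^sup>2 \<le> (1/2)\<^sup>2" "(Im \<sigma>)\<^sup>2 \<le> (1/2)\<^sup>2"
        using \<sigma> False Suc.prems by (auto simp: abs_le_square_iff [symmetric])
      hence "(norm \<sigma>)\<^sup>2 \<le> 1/2"
        unfolding cmod_power2 by (simp add: power2_eq_square)
      moreover have "norm \<sigma> > 0"
        using \<sigma> Suc.prems by auto
      ultimately have "Im \<sigma> / (norm \<sigma>)\<^sup>2 \<ge> 2 * Im \<sigma>"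
        using \<sigma> Suc.prems by (simp add: field_simps)
      hence "Im (- 1 / \<sigma>) \<ge> 2 * Im \<tau>"
        unfolding Im_inversion using \<sigma> by simp
      moreover have "(1/2 :: real) / 2 ^ n = 2 * ((1/2) / 2 ^ Suc n)" by simp
      ultimately have "(1/2) / 2 ^ n \<le> Im (- 1 / \<sigma>)" "0 < Im (- 1 / \<sigma>)"
        using Suc.prems by linarith+
      hence "\<exists>\<tau>'. Im \<tau>' \<ge> 1/2 \<and> \<bar>Re \<tau>'\<bar> \<le> 1/2 \<and> F \<tau>' = F (- 1 / \<sigma>)"
        by (rule Suc.IH)
      moreover have "F (- 1 / \<sigma>) = F \<tau>"
        using S[of \<sigma>] \<sigma> Suc.prems by simp
      ultimately show ?thesis by simp
    qed
  qed
qed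

abbreviation at_icusp :: "complex filter" where
  "at_icusp \<equiv> filtercomap Im at_top"

text \<open>If F were nonzero somewhere, its modulus would be smaller than that value above some
  height \<open>Y\<close>. Every value of F is taken in the strip of \<open>upper_reduction\<close>,
  so a maximum over the compact part below \<open>Y\<close> is a global maximum at an interior
  point. Then F is constant, against its limit 0.\<close>

lemma modular_function_eq_0:
  assumes hol: "F holomorphic_on upper"
    and T: "\<And>\<tau>. Im \<tau> > 0 \<Longrightarrow> F (\<tau> + 1) = F \<tau>"
    and S: "\<And>\<tau>. Im \<tau> > 0 \<Longrightarrow> F (- 1 / \<tau>) = F \<tau>"
    and lim: "(F \<longlongrightarrow> 0) at_icusp" and \<tau>0: "Im \<tau>0 > 0"
  shows "F \<tau>0 = 0"
proof (rule ccontr)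
  assume nz: "F \<tau>0 \<noteq> 0"
  have "eventually (\<lambda>\<tau>. norm (F \<tau>) < norm (F \<tau>0)) at_icusp"
    using lim nz by (auto simp: tendsto_iff dist_norm)
  then obtain Y where Y: "\<And>\<tau>. Im \<tau> \<ge> Y \<Longrightarrow> norm (F \<tau>) < norm (F \<tau>0)"
    by (auto simp: eventually_filtercomap_at_top_linorder)
  \<comment> \<open>The part of the reduction strip up to height \<open>Y\<close>, a rectangle
    inside the upper half-plane; it contains \<tau>1 and is therefore nonempty.\<close>
  define K where "K = cbox (Complex (-1/2) (1/2)) (Complex (1/2) Y)"
  have K_iff: "\<tau> \<in> K \<longleftrightarrow> \<bar>Re \<tau>\<bar> \<le> 1/2 \<and> Im \<tau> \<ge> 1/2 \<and> Im \<tau> \<le> Y" for \<tau>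
    by (auto simp: K_def in_cbox_complex_iff)
  have K_upper: "K \<subseteq> upper"
    by (auto simp: K_iff)
  obtain \<tau>1 where \<tau>1: "Im \<tau>1 \<ge> 1/2" "\<bar>Re \<tau>1\<bar> \<le> 1/2" "F \<tau>1 = F \<tau>0"
    using upper_reduction[OF T S \<tau>0] by blast
  have "\<tau>1 \<in> K"
    using \<tau>1 Y[of \<tau>1] by (auto simp: K_iff intro: leI)
  have "continuous_on K F"
    using hol K_upper by (meson continuous_on_subset holomorphic_on_imp_continuous_on)
  hence "\<exists>\<xi>\<in>K. \<forall>\<tau>\<in>K. norm (F \<tau>) \<le> norm (F \<xi>)"
    using \<open>\<tau>1 \<in> K\<close> by (intro continuous_attains_sup continuous_intros) (auto simp: K_def)
  then obtain \<xi> where \<xi>: "\<xi> \<in> K" "\<And>\<tau>. \<tau> \<in> K \<Longrightarrow> norm (F \<tau>) \<le> norm (F \<xi>)"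
    by blast
  have "norm (F \<tau>) \<le> norm (F \<xi>)" if "\<tau> \<in> upper" for \<tau>
  proof -
    have "Im \<tau> > 0" using that by simp
    from upper_reduction[OF T S this] obtain \<tau>' where
      \<tau>': "Im \<tau>' \<ge> 1/2" "\<bar>Re \<tau>'\<bar> \<le> 1/2" "F \<tau>' = F \<tau>" by blast
    show ?thesis
    proof (cases "Im \<tau>' \<le> Y")
      case True
      thus ?thesis using \<tau>' \<xi>(2)[of \<tau>'] by (auto simp: K_iff)
    next
      case False
      hence "norm (F \<tau>') < norm (F \<tau>0)" by (intro Y) auto
      also have "\<dots> \<le> norm (F \<xi>)" using \<xi>(2)[OF \<open>\<tau>1 \<in> K\<close>] \<tau>1 by simp
      finally show ?thesis using \<tau>' by simp
    qed
  qed
  hence "F constant_on upper"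
    using \<xi>(1) K_upper
    by (intro maximum_modulus_principle[OF hol open_upper connected_upper open_upper, of \<xi>]) auto
  then obtain c where c: "\<And>\<tau>. Im \<tau> > 0 \<Longrightarrow> F \<tau> = c"
    by (auto simp: constant_on_def)
  have "F (Complex 0 (max Y 1)) = F \<tau>0"
    using \<tau>0 by (simp add: c)
  thus False using Y[of "Complex 0 (max Y 1)"] by simp
qed

text \<open>By the identity theorem holomorphic functions on a connected open set form an integral
  domain: where one factor is nonzero the remaining product vanishes on an open set, hence
  everywhere.\<close>

lemma prod_eq_0_imp_factor_eq_0:
  assumes "finite I" "open A" "connected A" "A \<noteq> {}"
    and "\<And>i. i \<in> I \<Longrightarrow> f i holomorphic_on A"
    and "\<And>z. z \<in> A \<Longrightarrow> (\<Prod>i\<in>I. f i z) = 0"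
  shows "\<exists>i\<in>I. \<forall>z\<in>A. f i z = (0::complex)"
  using assms(1,5,6)
proof (induction I)
  case empty
  thus ?case using \<open>A \<noteq> {}\<close> by auto
next
  case (insert i I)
  show ?case
  proof (cases "\<forall>z\<in>A. f i z = 0")
    case False
    define B where "B = {z \<in> A. f i z \<noteq> 0}"
    have "continuous_on A (f i)"
      using insert.prems(1) by (intro holomorphic_on_imp_continuous_on) auto
    hence "open B"
      unfolding B_def using \<open>open A\<close> continuous_open_preimage[of A "f i" "- {0}"]
      by (auto simp: vimage_def Int_def)
    have "(\<Prod>i\<in>I. f i z) = 0" if "z \<in> A" for z
    proof (rule analytic_continuation_open[of B A "\<lambda>z. \<Prod>i\<in>I. f i z" "\<lambda>_. 0"])
      show "(\<lambda>z. \<Prod>i\<in>I. f i z) holomorphic_on A"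
        using insert.prems(1) by (intro holomorphic_intros) auto
      show "(\<Prod>i\<in>I. f i z) = 0" if "z \<in> B" for z
        using insert.prems(2)[of z] insert.hyps that by (auto simp: B_def)
    qed (use \<open>open B\<close> assms False that in \<open>auto simp: B_def\<close>)
    hence "\<exists>i\<in>I. \<forall>z\<in>A. f i z = 0"
      using insert.prems by (intro insert.IH) auto
    thus ?thesis by auto
  qed auto
qed

section \<open>Products of Siegel functions of level 60\<close>

lemma ee_sum: "ee (\<Sum>s\<in>S. f s) = (\<Prod>s\<in>S. ee (f s))"
  by (induction S rule: infinite_finite_induct) (simp_all add: ee_add)

lemma sieg_shift1_int:
  assumes "Im \<tau> > 0"
  shows "sieg (a + of_int n) b \<tau> = ee (of_int n * (1 - b) / 2) * sieg a b \<tau>"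
proof -
  \<comment> \<open>The sign is written as \<open>ee (1/2)\<close>, so that iterating the shift only
    adds exponents.\<close>
  have 1: "- ee (- b / 2) = ee ((1 - b) / 2)"
    by (simp add: diff_divide_distrib ee_diff ee_minus)
  have nat: "sieg (a + of_nat n) b \<tau> = ee (of_nat n * (1 - b) / 2) * sieg a b \<tau>" for a n
  proof (induction n)
    case (Suc n)
    have "sieg (a + of_nat (Suc n)) b \<tau> = sieg ((a + of_nat n) + 1) b \<tau>"
      by (simp add: add_ac)
    also have "\<dots> = ee ((1 - b) / 2) * (ee (of_nat n * (1 - b) / 2) * sieg a b \<tau>)"
      by (simp only: sieg_shift1[OF assms] 1 Suc)
    also have "\<dots> = (ee ((1 - b) / 2) * ee (of_nat n * (1 - b) / 2)) * sieg a b \<tau>"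
      by simp
    also have "ee ((1 - b) / 2) * ee (of_nat n * (1 - b) / 2) = ee (of_nat (Suc n) * (1 - b) / 2)"
      unfolding ee_add [symmetric] by (rule arg_cong[of _ _ ee]) (simp add: field_simps)
    finally show ?case .
  qed simp
  show ?thesis
  proof (cases "n \<ge> 0")
    case True
    thus ?thesis using nat[of a "nat n"] by simp
  next
    case False
    hence "sieg a b \<tau> = ee (- of_int n * (1 - b) / 2) * sieg (a + of_int n) b \<tau>"
      using nat[of "a + of_int n" "nat (-n)"] by simp
    moreover have "ee (of_int n * (1 - b) / 2) * ee (- of_int n * (1 - b) / 2) = 1"
      by (simp add: ee_add [symmetric])
    ultimately show ?thesis
      by (metis mult.assoc mult_1)
  qed
qed

lemma sieg_shift2_int: "sieg a (b + of_int n) \<tau> = ee (of_int n * (1 + a) / 2) * sieg a b \<tau>"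
proof -
  have 1: "- ee (a / 2) = ee ((1 + a) / 2)"
    by (simp add: add_divide_distrib ee_add)
  have nat: "sieg a (b + of_nat n) \<tau> = ee (of_nat n * (1 + a) / 2) * sieg a b \<tau>" for b n
  proof (induction n)
    case (Suc n)
    have "sieg a (b + of_nat (Suc n)) \<tau> = sieg a ((b + of_nat n) + 1) \<tau>"
      by (simp add: add_ac)
    also have "\<dots> = ee ((1 + a) / 2) * (ee (of_nat n * (1 + a) / 2) * sieg a b \<tau>)"
      by (simp only: sieg_shift2 1 Suc)
    also have "\<dots> = (ee ((1 + a) / 2) * ee (of_nat n * (1 + a) / 2)) * sieg a b \<tau>"
      by simp
    also have "ee ((1 + a) / 2) * ee (of_nat n * (1 + a) / 2) = ee (of_nat (Suc n) * (1 + a) / 2)"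
      unfolding ee_add [symmetric] by (rule arg_cong[of _ _ ee]) (simp add: field_simps)
    finally show ?case .
  qed simp
  show ?thesis
  proof (cases "n \<ge> 0")
    case True
    thus ?thesis using nat[of b "nat n"] by simp
  next
    case False
    hence "sieg a b \<tau> = ee (- of_int n * (1 + a) / 2) * sieg a (b + of_int n) \<tau>"
      using nat[of "b + of_int n" "nat (-n)"] by simp
    moreover have "ee (of_int n * (1 + a) / 2) * ee (- of_int n * (1 + a) / 2) = 1"
      by (simp add: ee_add [symmetric])
    ultimately show ?thesis
      by (metis mult.assoc mult_1)
  qed
qed

text \<open>For \<open>v = (1, 0)\<close> and \<open>q = ee (\<tau> / 60)\<close>, \<open>1 / siegprod S v\<close> is a power of \<open>q\<close> times the generating
  function of the partitions into parts congruent to \<open>\<plusminus>s\<close> modulo 60, \<open>s \<in> S\<close>.\<close>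

definition siegprod :: "int set \<Rightarrow> int \<times> int \<Rightarrow> complex \<Rightarrow> complex" where
  "siegprod S v \<tau> = ee \<tau> * (\<Prod>s\<in>S. sieg (of_int (s * fst v) / 60) (of_int (s * snd v) / 60) \<tau>)"

text \<open>The twelve factors match the twelfth power known from \<open>sieg_inversion\<close>.
  Shifting \<open>t\<close> or \<open>r\<close> by 60 k multiplies the product by \<open>ee\<close>
  of k/2 times the sum of s, plus or minus kr/120 or kt/120 times the sum of s^2; the divisibility
  conditions make this an integer.\<close>

definition admissible :: "int set \<Rightarrow> bool" where
  "admissible S \<longleftrightarrow> card S = 12 \<and> 120 dvd (\<Sum>s\<in>S. s\<^sup>2) \<and> even (\<Sum>S)"

lemma siegprod_shift1:
  assumes S: "admissible S" and \<tau>: "Im \<tau> > 0"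
  shows "siegprod S (r + 60 * k, t) \<tau> = siegprod S (r, t) \<tau>"
proof -
  obtain c d where c: "(\<Sum>s\<in>S. s\<^sup>2) = 120 * c" and d: "\<Sum>S = 2 * d"
    using S by (auto simp: admissible_def elim!: dvdE evenE)
  have "sieg (of_int (s * (r + 60 * k)) / 60) (of_int (s * t) / 60) \<tau> =
      ee (of_int (s * k) * (1 - of_int (s * t) / 60) / 2) * sieg (of_int (s * r) / 60) (of_int (s * t) / 60) \<tau>" for s
    using sieg_shift1_int[OF \<tau>, of "of_int (s * r) / 60" "s * k" "of_int (s * t) / 60"]
    by (simp add: ring_distribs add_divide_distrib)
  hence "siegprod S (r + 60 * k, t) \<tau> =
      (\<Prod>s\<in>S. ee (of_int (s * k) * (1 - of_int (s * t) / 60) / 2)) * siegprod S (r, t) \<tau>"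
    by (simp add: siegprod_def prod.distrib mult_ac)
  also have "(\<Prod>s\<in>S. ee (of_int (s * k) * (1 - of_int (s * t) / 60) / 2)) =
      ee (\<Sum>s\<in>S. of_int k / 2 * of_int s - of_int k * of_int t / 120 * of_int (s\<^sup>2))"
    unfolding ee_sum [symmetric]
    by (intro arg_cong[of _ _ ee] sum.cong) (auto simp: field_simps power2_eq_square)
  also have "(\<Sum>s\<in>S. of_int k / 2 * of_int s - of_int k * of_int t / 120 * of_int (s\<^sup>2) :: complex) =
      of_int k / 2 * of_int (\<Sum>S) - of_int k * of_int t / 120 * of_int (\<Sum>s\<in>S. s\<^sup>2)"
    by (simp only: sum_subtractf sum_distrib_left [symmetric] of_int_sum)
  also have "\<dots> = of_int (k * d - k * t * c)"
    unfolding c d by simp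
  finally show ?thesis by (simp only: ee_of_int mult_1)
qed

lemma siegprod_shift2:
  assumes S: "admissible S"
  shows "siegprod S (r, t + 60 * k) \<tau> = siegprod S (r, t) \<tau>"
proof -
  obtain c d where c: "(\<Sum>s\<in>S. s\<^sup>2) = 120 * c" and d: "\<Sum>S = 2 * d"
    using S by (auto simp: admissible_def elim!: dvdE evenE)
  have "sieg (of_int (s * r) / 60) (of_int (s * (t + 60 * k)) / 60) \<tau> =
      ee (of_int (s * k) * (1 + of_int (s * r) / 60) / 2) * sieg (of_int (s * r) / 60) (of_int (s * t) / 60) \<tau>" for s
    using sieg_shift2_int[of "of_int (s * r) / 60" "of_int (s * t) / 60" "s * k" \<tau>]
    by (simp add: ring_distribs add_divide_distrib)
  hence "siegprod S (r, t + 60 * k) \<tau> =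
      (\<Prod>s\<in>S. ee (of_int (s * k) * (1 + of_int (s * r) / 60) / 2)) * siegprod S (r, t) \<tau>"
    by (simp add: siegprod_def prod.distrib mult_ac)
  also have "(\<Prod>s\<in>S. ee (of_int (s * k) * (1 + of_int (s * r) / 60) / 2)) =
      ee (\<Sum>s\<in>S. of_int k / 2 * of_int s + of_int k * of_int r / 120 * of_int (s\<^sup>2))"
    unfolding ee_sum [symmetric]
    by (intro arg_cong[of _ _ ee] sum.cong) (auto simp: field_simps power2_eq_square)
  also have "(\<Sum>s\<in>S. of_int k / 2 * of_int s + of_int k * of_int r / 120 * of_int (s\<^sup>2) :: complex) =
      of_int k / 2 * of_int (\<Sum>S) + of_int k * of_int r / 120 * of_int (\<Sum>s\<in>S. s\<^sup>2)"
    by (simp only: sum.distrib sum_distrib_left [symmetric] of_int_sum)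
  also have "\<dots> = of_int (k * d + k * r * c)"
    unfolding c d by simp
  finally show ?thesis by (simp only: ee_of_int mult_1)
qed

lemma siegprod_mod:
  assumes "admissible S" "Im \<tau> > 0"
  shows "siegprod S (r mod 60, t mod 60) \<tau> = siegprod S (r, t) \<tau>"
proof -
  have "siegprod S (r mod 60 + 60 * (r div 60), t mod 60 + 60 * (t div 60)) \<tau> = siegprod S (r mod 60, t mod 60) \<tau>"
    by (simp only: siegprod_shift1[OF assms] siegprod_shift2[OF assms(1)])
  thus ?thesis by simp
qed

lemma siegprod_plus_1: "siegprod S (r, t) (\<tau> + 1) = siegprod S (r, r + t) \<tau>"
  by (simp add: siegprod_def sieg_plus_1 ee_add ring_distribs add_divide_distrib)

text \<open>The normalizing factor exactly absorbs the multiplier: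
  \<open>ee (- 1 / \<tau>) * ee (\<tau> + 1 / \<tau>) = ee \<tau>\<close>. The characteristic is
  thus permuted without any constant.\<close>

lemma siegprod_inversion:
  assumes S: "admissible S" and \<tau>: "Im \<tau> > 0"
  shows "siegprod S (r, t) (- 1 / \<tau>) = siegprod S (t, - r) \<tau>"
proof -
  obtain C where C: "\<And>a b. sieg a b (- 1 / \<tau>) = C * sieg b (- a) \<tau>" "C ^ 12 = ee (\<tau> + 1 / \<tau>)"
    using sieg_inversion[OF \<tau>] by blast
  have card: "card S = 12" using S by (simp add: admissible_def)
  have "ee (- 1 / \<tau>) * C ^ 12 = ee \<tau>"
    unfolding C ee_add [symmetric] by simp
  hence eq: "ee (- 1 / \<tau>) * (C ^ 12 * P) = ee \<tau> * P" for P
    by (metis mult.assoc)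
  show ?thesis
    unfolding siegprod_def C(1) prod.distrib prod_constant card fst_conv snd_conv eq by simp
qed

lemma holomorphic_siegprod: "siegprod S v holomorphic_on upper"
  unfolding siegprod_def [abs_def] sieg_def
  by (intro holomorphic_intros holomorphic_jac open_upper) (auto simp: norm_ee_less_1)

lemma sieg_nonzero:
  assumes "Im \<tau> > 0" "0 < k" "k < 60"
  shows "sieg (of_int k / 60) 0 \<tau> \<noteq> 0"
proof -
  have "jtheta (of_int k / 60 * \<tau>) \<tau> \<noteq> 0"
  proof
    assume "jtheta (of_int k / 60 * \<tau>) \<tau> = 0"
    then obtain m n :: int where "of_int k / 60 * \<tau> = of_int m + of_int n * \<tau>"
      using jtheta_eq_0_iff[OF assms(1)] by blast
    hence "Im (of_int k / 60 * \<tau>) = Im (of_int m + of_int n * \<tau>)" by simp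
    hence "of_int k = (60 * of_int n :: real)"
      using assms(1) by simp
    hence "k = 60 * n" by linarith
    thus False using assms by presburger
  qed
  thus ?thesis by (simp add: sieg_conv_jtheta)
qed

section \<open>Growth at the cusp and the orbit of characteristics\<close>

lemma tendsto_ee_icusp: "((\<lambda>\<tau>. ee (\<tau> / 60)) \<longlongrightarrow> 0) at_icusp"
proof (rule tendsto_norm_zero_cancel)
  have "((\<lambda>y::real. exp (- 2 * pi * (y / 60))) \<longlongrightarrow> 0) at_top"
    by real_asymp
  from filterlim_filtercomapI[OF this, of Im]
  show "((\<lambda>\<tau>. norm (ee (\<tau> / 60))) \<longlongrightarrow> 0) at_icusp"
    by (simp add: norm_ee)
qed

lemma eventually_icusp_upper: "eventually (\<lambda>\<tau>. Im \<tau> > 0) at_icusp"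
  unfolding eventually_filtercomap_at_top_dense by blast

text \<open>In the local parameter x = \<open>ee (\<tau> / 60)\<close>, \<open>sieg\<close> is a
  constant times x^(-k(60 - k)/120) times a function \<open>G\<close> holomorphic at x = 0. There
  \<open>G\<close> equals 1 if k > 0 and \<open>1 - ee \<beta>\<close> if k = 0, so it is
  nonzero.\<close>

lemma inverse_sieg_bigo_aux:
  assumes k: "k < 60" and nz: "\<not> (k = 0 \<and> ee \<beta> = 1)"
  shows "(\<lambda>\<tau>. 1 / sieg (of_nat k / 60) \<beta> \<tau>) \<in>
           O[at_icusp](\<lambda>\<tau>. ee (of_nat (k * (60 - k)) / 120 * \<tau> / 60))"
proof (rule bigoI_tendsto)
  define G where "G = (\<lambda>x. qprod (ee \<beta> * x ^ k) (x ^ 60) * qprod (x ^ (60 - k) / ee \<beta>) (x ^ 60))"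
  have "G holomorphic_on ball 0 1"
    unfolding G_def by (intro holomorphic_intros holomorphic_qprod) (auto simp: norm_power power_less_one_iff)
  hence "isCont G 0"
    using holomorphic_on_imp_continuous_on continuous_on_eq_continuous_at[OF open_ball] by (metis centre_in_ball zero_less_one)
  hence lim: "((\<lambda>\<tau>. G (ee (\<tau> / 60))) \<longlongrightarrow> G 0) at_icusp"
    using tendsto_ee_icusp by (rule isCont_tendsto_compose)
  have G0: "G 0 \<noteq> 0"
    using nz k by (cases "k = 0") (auto simp: G_def qprod_0_right power_0_left)
  have sieg: "sieg (of_nat k / 60) \<beta> \<tau> =
      ee ((of_nat k / 60 - 1) * \<beta> / 2) / ee (of_nat (k * (60 - k)) / 120 * \<tau> / 60) * G (ee (\<tau> / 60))" for \<tau>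
  proof -
    have 1: "ee (of_nat k / 60 * \<tau> + \<beta>) = ee \<beta> * ee (\<tau> / 60) ^ k"
      unfolding ee_power ee_add [symmetric] by (rule arg_cong[of _ _ ee]) simp
    have 2: "ee \<tau> = ee (\<tau> / 60) ^ 60"
      by (simp add: ee_power)
    have 3: "ee (\<tau> / 60) ^ 60 / (ee \<beta> * ee (\<tau> / 60) ^ k) = ee (\<tau> / 60) ^ (60 - k) / ee \<beta>"
      using k by (simp add: power_diff)
    have e: "(of_nat (k * (60 - k)) :: complex) = of_nat k * (60 - of_nat k)"
      using k by (simp add: of_nat_diff)
    have 4: "ee ((of_nat k / 60 - 1) * (of_nat k / 60 * \<tau> + \<beta>) / 2) =
        ee ((of_nat k / 60 - 1) * \<beta> / 2) / ee (of_nat (k * (60 - k)) / 120 * \<tau> / 60)"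
      unfolding ee_diff [symmetric] e by (intro arg_cong[of _ _ ee]) (simp add: field_simps)
    show ?thesis
      unfolding sieg_def jac_def 1 4 2 3 G_def ..
  qed
  have "((\<lambda>\<tau>. 1 / ee ((of_nat k / 60 - 1) * \<beta> / 2) / G (ee (\<tau> / 60))) \<longlongrightarrow>
      1 / ee ((of_nat k / 60 - 1) * \<beta> / 2) / G 0) at_icusp"
    by (intro tendsto_divide tendsto_const lim G0)
  also have "(\<lambda>\<tau>. 1 / ee ((of_nat k / 60 - 1) * \<beta> / 2) / G (ee (\<tau> / 60))) =
      (\<lambda>\<tau>. 1 / sieg (of_nat k / 60) \<beta> \<tau> / ee (of_nat (k * (60 - k)) / 120 * \<tau> / 60))"
    unfolding sieg by (simp add: field_simps)
  finally show "((\<lambda>\<tau>. 1 / sieg (of_nat k / 60) \<beta> \<tau> / ee (of_nat (k * (60 - k)) / 120 * \<tau> / 60))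
     \<longlongrightarrow> 1 / ee ((of_nat k / 60 - 1) * \<beta> / 2) / G 0) at_icusp" .
qed auto

text \<open>\<open>cuspord m\<close> is 120 times the order of \<open>1 / sieg (m / 60) \<beta>\<close> at the cusp, measured in the
  local parameter \<open>ee (\<tau> / 60)\<close>; in the same unit the factor \<open>1 / ee \<tau>\<close> of \<open>1 / siegprod\<close>
  contributes \<open>-7200\<close>.\<close>

definition cuspord :: "int \<Rightarrow> int" where
  "cuspord m = (m mod 60) * (60 - m mod 60)"

text \<open>Reducing \<open>m\<close> modulo 60 costs only a constant factor. The hypothesis
  excludes the integral characteristics, where \<open>sieg\<close> vanishes identically; any one
  point of nonvanishing suffices for that.\<close>

lemma inverse_sieg_bigo:
  assumes nz: "\<exists>\<tau>. sieg (of_int m / 60) \<beta> \<tau> \<noteq> 0 \<and> Im \<tau> > 0"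
  shows "(\<lambda>\<tau>. 1 / sieg (of_int m / 60) \<beta> \<tau>) \<in>
           O[at_icusp](\<lambda>\<tau>. ee (of_int (cuspord m) / 120 * \<tau> / 60))"
proof -
  define k where "k = nat (m mod 60)"
  define n where "n = m div 60"
  have k: "k < 60" "int k = m mod 60"
    unfolding k_def by (auto simp: nat_less_iff)
  have m: "m = int k + 60 * n"
    using k by (simp add: n_def)
  define c where "c = ee (of_int n * (1 - \<beta>) / 2)"
  have c: "c \<noteq> 0" by (simp add: c_def)
  have sieg: "sieg (of_int m / 60) \<beta> \<tau> = c * sieg (of_nat k / 60) \<beta> \<tau>" if "Im \<tau> > 0" for \<tau>
    using sieg_shift1_int[OF that, of "of_nat k / 60" n \<beta>] by (simp add: m c_def add_divide_distrib)
  have "\<not> (k = 0 \<and> ee \<beta> = 1)"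
  proof
    assume *: "k = 0 \<and> ee \<beta> = 1"
    obtain \<tau> where \<tau>: "Im \<tau> > 0" "sieg (of_int m / 60) \<beta> \<tau> \<noteq> 0"
      using nz by blast
    have "qprod 1 (ee \<tau>) = 0"
      using qprod_head[OF norm_ee_less_1[OF \<tau>(1)], of 1] by simp
    hence "sieg (of_nat k / 60) \<beta> \<tau> = 0"
      using * by (simp add: sieg_def jac_def)
    thus False using \<tau> sieg by simp
  qed
  from inverse_sieg_bigo_aux[OF k(1) this]
  have A: "(\<lambda>\<tau>. 1 / c * (1 / sieg (of_nat k / 60) \<beta> \<tau>)) \<in>
      O[at_icusp](\<lambda>\<tau>. ee (of_nat (k * (60 - k)) / 120 * \<tau> / 60))"
    by (subst landau_o.big.cmult_in_iff) (use c in simp)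
  have B: "eventually (\<lambda>\<tau>. 1 / c * (1 / sieg (of_nat k / 60) \<beta> \<tau>) = 1 / sieg (of_int m / 60) \<beta> \<tau>) at_icusp"
    by (intro eventually_mono[OF eventually_icusp_upper]) (simp add: sieg)
  have "(\<lambda>\<tau>. 1 / sieg (of_int m / 60) \<beta> \<tau>) \<in>
      O[at_icusp](\<lambda>\<tau>. ee (of_nat (k * (60 - k)) / 120 * \<tau> / 60))"
    by (rule iffD1[OF landau_o.big.in_cong[OF B] A])
  also have "(of_nat (k * (60 - k)) :: complex) = of_int (int (k * (60 - k)))"
    by simp
  also have "int (k * (60 - k)) = cuspord m"
    using k by (simp add: cuspord_def of_nat_diff)
  finally show ?thesis .
qed

lemma inverse_siegprod_bigo:
  assumes \<tau>: "Im \<tau> > 0" and nz: "siegprod S (r, t) \<tau> \<noteq> 0" and fin: "finite S"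
  shows "(\<lambda>\<tau>. 1 / siegprod S (r, t) \<tau>) \<in>
           O[at_icusp](\<lambda>\<tau>. ee (of_int ((\<Sum>s\<in>S. cuspord (s * r)) - 7200) / 120 * \<tau> / 60))"
proof -
  have "(\<lambda>\<tau>. \<Prod>s\<in>S. 1 / sieg (of_int (s * r) / 60) (of_int (s * t) / 60) \<tau>) \<in>
      O[at_icusp](\<lambda>\<tau>. \<Prod>s\<in>S. ee (of_int (cuspord (s * r)) / 120 * \<tau> / 60))"
  proof (rule landau_o.big_prod)
    fix s assume "s \<in> S"
    hence "sieg (of_int (s * r) / 60) (of_int (s * t) / 60) \<tau> \<noteq> 0"
      using nz fin by (auto simp: siegprod_def)
    thus "(\<lambda>\<tau>. 1 / sieg (of_int (s * r) / 60) (of_int (s * t) / 60) \<tau>)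
         \<in> O[at_icusp](\<lambda>\<tau>. ee (of_int (cuspord (s * r)) / 120 * \<tau> / 60))"
      using \<tau> by (intro inverse_sieg_bigo) blast
  qed
  hence "(\<lambda>\<tau>. ee (- \<tau>) * (\<Prod>s\<in>S. 1 / sieg (of_int (s * r) / 60) (of_int (s * t) / 60) \<tau>)) \<in>
      O[at_icusp](\<lambda>\<tau>. ee (- \<tau>) * (\<Prod>s\<in>S. ee (of_int (cuspord (s * r)) / 120 * \<tau> / 60)))"
    by (intro landau_o.big_mult) auto
  also have "(\<lambda>\<tau>. ee (- \<tau>) * (\<Prod>s\<in>S. 1 / sieg (of_int (s * r) / 60) (of_int (s * t) / 60) \<tau>)) =
      (\<lambda>\<tau>. 1 / siegprod S (r, t) \<tau>)"
    by (simp add: siegprod_def ee_minus prod_dividef)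
  also have "(\<lambda>\<tau>. ee (- \<tau>) * (\<Prod>s\<in>S. ee (of_int (cuspord (s * r)) / 120 * \<tau> / 60))) =
      (\<lambda>\<tau>. ee (of_int ((\<Sum>s\<in>S. cuspord (s * r)) - 7200) / 120 * \<tau> / 60))"
  proof
    fix \<tau> :: complex
    have "(\<Sum>s\<in>S. of_int (cuspord (s * r)) / 120 * \<tau> / 60) = of_int (\<Sum>s\<in>S. cuspord (s * r)) / 120 * \<tau> / 60"
      by (simp add: sum_distrib_right sum_divide_distrib)
    thus "ee (- \<tau>) * (\<Prod>s\<in>S. ee (of_int (cuspord (s * r)) / 120 * \<tau> / 60)) =
        ee (of_int ((\<Sum>s\<in>S. cuspord (s * r)) - 7200) / 120 * \<tau> / 60)"
      unfolding ee_sum [symmetric] ee_add [symmetric]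
      by (intro arg_cong[of _ _ ee]) (simp add: field_simps)
  qed
  finally show ?thesis .
qed

lemma ee_bigo_mono:
  fixes a b :: real
  assumes "b \<le> a"
  shows "(\<lambda>\<tau>. ee (of_real a * \<tau> / 60)) \<in> O[at_icusp](\<lambda>\<tau>. ee (of_real b * \<tau> / 60))"
proof (rule landau_o.big_mono, rule eventually_mono[OF eventually_icusp_upper])
  fix \<tau> :: complex assume "Im \<tau> > 0"
  thus "norm (ee (of_real a * \<tau> / 60)) \<le> norm (ee (of_real b * \<tau> / 60))"
    using assms by (simp add: norm_ee mult_right_mono)
qed

text \<open>The orbit of \<open>(1, 0)\<close> under the right action of the modular group on row vectors modulo 60.\<close>

inductive_set orbit :: "(int \<times> int) set" where
  orbit_base: "(1, 0) \<in> orbit"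
| orbit_T: "(r, t) \<in> orbit \<Longrightarrow> (r, (r + t) mod 60) \<in> orbit"
| orbit_S: "(r, t) \<in> orbit \<Longrightarrow> (t, (- r) mod 60) \<in> orbit"

lemma orbit_range: "(r, t) \<in> orbit \<Longrightarrow> r \<in> {0..<60} \<and> t \<in> {0..<60}"
  by (induction rule: orbit.induct) auto

lemma orbit_subset: "orbit \<subseteq> {0..<60} \<times> {0..<60}"
  using orbit_range by (auto simp: mem_Times_iff)

lemma finite_orbit: "finite orbit"
  by (rule finite_subset[OF orbit_subset]) auto

lemma orbit_T_power: "(r, t) \<in> orbit \<Longrightarrow> (r, (t + int k * r) mod 60) \<in> orbit"
proof (induction k)
  case 0
  thus ?case using orbit_range by fastforce
next
  case (Suc k)
  from orbit_T[OF Suc.IH[OF Suc.prems]] show ?case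
    by (simp add: mod_simps algebra_simps)
qed

text \<open>Negative powers reduce to nonnegative ones because the 60th power of the translation
  acts trivially modulo 60.\<close>

lemma orbit_T_int:
  assumes "(r, t) \<in> orbit" shows "(r, (t + k * r) mod 60) \<in> orbit"
proof -
  have "(r, (t + int (nat (k mod 60)) * r) mod 60) \<in> orbit"
    by (rule orbit_T_power[OF assms])
  also have "(t + int (nat (k mod 60)) * r) mod 60 = (t + k * r) mod 60"
    by simp (metis mod_add_right_eq mod_mult_left_eq)
  finally show ?thesis .
qed

text \<open>The inversion has order four on row vectors, so its inverse is its cube.\<close>

lemma orbit_S_inverse:
  assumes "(r, t) \<in> orbit" shows "((- t) mod 60, r) \<in> orbit"
  using orbit_S[OF orbit_S[OF orbit_S[OF assms]]] orbit_range[OF assms] by (simp add: mod_simps)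

text \<open>An injective self-map of a finite set is surjective. The generators therefore merely
  permute the factors of the norm.\<close>

lemma bij_betw_orbit_T: "bij_betw (\<lambda>(r, t). (r, (r + t) mod 60)) orbit orbit"
proof -
  have inj: "inj_on (\<lambda>(r, t). (r, (r + t) mod 60)) orbit"
  proof (rule inj_onI, clarsimp)
    fix r t t' assume "(r, t) \<in> orbit" "(r, t') \<in> orbit" and *: "(r + t) mod 60 = (r + t') mod 60"
    hence "0 \<le> t" "t < 60" "0 \<le> t'" "t' < 60" using orbit_range by fastforce+
    moreover have "60 dvd (r + t) - (r + t')" using * by (rule mod_eq_dvd_iff[THEN iffD1])
    then obtain k where k: "t - t' = 60 * k" by (auto elim!: dvdE)
    ultimately have "k = 0" by linarith
    thus "t = t'" using k by simp
  qed
  have "(\<lambda>(r, t). (r, (r + t) mod 60)) ` orbit \<subseteq> orbit"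
    using orbit_T by auto
  with inj show ?thesis
    unfolding bij_betw_def using endo_inj_surj[OF finite_orbit] by blast
qed

lemma bij_betw_orbit_S: "bij_betw (\<lambda>(r, t). (t, (- r) mod 60)) orbit orbit"
proof -
  have inj: "inj_on (\<lambda>(r, t). (t, (- r) mod 60)) orbit"
  proof (rule inj_onI, clarsimp)
    fix r t r' assume "(r, t) \<in> orbit" "(r', t) \<in> orbit" and *: "(- r) mod 60 = (- r') mod 60"
    hence "0 \<le> r" "r < 60" "0 \<le> r'" "r' < 60" using orbit_range by fastforce+
    moreover have "60 dvd (- r) - (- r')" using * by (rule mod_eq_dvd_iff[THEN iffD1])
    then obtain k where k: "r' - r = 60 * k" by (auto elim!: dvdE)
    ultimately have "k = 0" by linarith
    thus "r = r'" using k by simp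
  qed
  have "(\<lambda>(r, t). (t, (- r) mod 60)) ` orbit \<subseteq> orbit"
    using orbit_S by auto
  with inj show ?thesis
    unfolding bij_betw_def using endo_inj_surj[OF finite_orbit] by blast
qed

lemma siegprod_orbit_T:
  assumes "admissible S" "Im \<tau> > 0"
  shows "siegprod S (r, (r + t) mod 60) \<tau> = siegprod S (r, t) (\<tau> + 1)"
  unfolding siegprod_plus_1
  using siegprod_mod[OF assms, of r "r + t"] siegprod_mod[OF assms, of r "(r + t) mod 60"] by simp

lemma siegprod_orbit_S:
  assumes "admissible S" "Im \<tau> > 0"
  shows "siegprod S (t, (- r) mod 60) \<tau> = siegprod S (r, t) (- 1 / \<tau>)"
  unfolding siegprod_inversion[OF assms]
  using siegprod_mod[OF assms, of t "- r"] siegprod_mod[OF assms, of t "(- r) mod 60"] by simp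

text \<open>At \<open>(1, 0)\<close> the factors have characteristics s/60 with 0 < s < 60, which
  avoid the zeros of the theta function. The substitutions \<tau> + 1 and -1/\<tau> carry this along
  the orbit, so all conjugates of the reciprocals are holomorphic.\<close>

lemma siegprod_orbit_nonzero:
  assumes S: "admissible S" "S \<subseteq> {0<..<60}"
  shows "(r, t) \<in> orbit \<Longrightarrow> Im \<tau> > 0 \<Longrightarrow> siegprod S (r, t) \<tau> \<noteq> 0"
proof (induction arbitrary: \<tau> rule: orbit.induct)
  case orbit_base
  have "finite S" using S(1) by (auto simp: admissible_def card_eq_0_iff intro: ccontr)
  thus ?case
    using S(2) orbit_base sieg_nonzero by (auto simp: siegprod_def)
next
  case (orbit_T r t \<tau>)
  thus ?case using siegprod_orbit_T[OF S(1)] by simp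
next
  case (orbit_S r t \<tau>)
  thus ?case using siegprod_orbit_S[OF S(1)] upper_inversion by simp
qed

section \<open>The norm of the defect\<close>

abbreviation (input) resS :: "int set" where
  "resS \<equiv> {1, 6, 7, 8, 11, 13, 18, 19, 20, 21, 23, 25}"

abbreviation (input) resT :: "int set" where
  "resT \<equiv> {1, 5, 6, 7, 13, 17, 18, 19, 20, 21, 28, 29}"

lemma admissible_resS: "admissible resS" and admissible_resT: "admissible resT"
  by (simp_all add: admissible_def)

definition Phi :: "int \<times> int \<Rightarrow> complex \<Rightarrow> complex" where
  "Phi v \<tau> = 1 / siegprod resS v \<tau> - 1 / siegprod resT v \<tau> - 1"

lemma Phi_T: "Im \<tau> > 0 \<Longrightarrow> Phi (r, (r + t) mod 60) \<tau> = Phi (r, t) (\<tau> + 1)"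
  unfolding Phi_def siegprod_orbit_T[OF admissible_resS] siegprod_orbit_T[OF admissible_resT] ..

lemma Phi_S: "Im \<tau> > 0 \<Longrightarrow> Phi (t, (- r) mod 60) \<tau> = Phi (r, t) (- 1 / \<tau>)"
  unfolding Phi_def siegprod_orbit_S[OF admissible_resS] siegprod_orbit_S[OF admissible_resT] ..

text \<open>The square of the inversion fixes every \<tau> but negates the characteristic.\<close>

lemma Phi_uminus:
  assumes "Im \<tau> > 0"
  shows "Phi ((- r) mod 60, (- t) mod 60) \<tau> = Phi (r, t) \<tau>"
proof -
  have [simp]: "\<tau> \<noteq> 0" using assms by auto
  have "Phi ((- r) mod 60, (- t) mod 60) \<tau> = Phi (t, (- r) mod 60) (- 1 / \<tau>)"
    by (rule Phi_S[OF assms])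
  also have "\<dots> = Phi (r, t) (- 1 / (- 1 / \<tau>))"
    by (rule Phi_S[OF upper_inversion[OF assms]])
  finally show ?thesis by simp
qed

lemma Phi_T_power: "Im \<tau> > 0 \<Longrightarrow> Phi (1, int n mod 60) \<tau> = Phi (1, 0) (\<tau> + of_nat n)"
proof (induction n arbitrary: \<tau>)
  case (Suc n)
  have "Phi (1, int (Suc n) mod 60) \<tau> = Phi (1, (1 + int n mod 60) mod 60) \<tau>"
    by (simp add: mod_simps)
  also have "\<dots> = Phi (1, int n mod 60) (\<tau> + 1)"
    by (rule Phi_T[OF Suc.prems])
  also have "\<dots> = Phi (1, 0) (\<tau> + 1 + of_nat n)"
    using Suc.prems by (intro Suc.IH) simp
  finally show ?case by (simp add: add_ac)
qed simp

lemma siegprod_res_nonzero: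
  assumes "(r, t) \<in> orbit" "Im \<tau> > 0"
  shows "siegprod resS (r, t) \<tau> \<noteq> 0" "siegprod resT (r, t) \<tau> \<noteq> 0"
  using siegprod_orbit_nonzero[OF admissible_resS _ assms] siegprod_orbit_nonzero[OF admissible_resT _ assms]
  by auto

lemma holomorphic_Phi:
  assumes "(r, t) \<in> orbit"
  shows "Phi (r, t) holomorphic_on upper"
  unfolding Phi_def [abs_def]
  by (intro holomorphic_intros holomorphic_siegprod) (use siegprod_res_nonzero[OF assms] in auto)

text \<open>The 0 in the minimum is the order of the constant term of \<open>Phi\<close>. It also
  keeps the value nonpositive, so that counting characteristics outside the orbit can only lower the
  total.\<close>

definition Phi_ord :: "int \<Rightarrow> int" where
  "Phi_ord r = min 0 (min ((\<Sum>s\<in>resS. cuspord (s * r)) - 7200) ((\<Sum>s\<in>resT. cuspord (s * r)) - 7200))"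

lemma Phi_bigo:
  assumes v: "(r, t) \<in> orbit"
  shows "Phi (r, t) \<in> O[at_icusp](\<lambda>\<tau>. ee (of_real (real_of_int (Phi_ord r) / 120) * \<tau> / 60))"
proof -
  let ?g = "\<lambda>\<tau>. ee (of_real (real_of_int (Phi_ord r) / 120) * \<tau> / 60)"
  have *: "(\<lambda>\<tau>. 1 / siegprod S (r, t) \<tau>) \<in> O[at_icusp](?g)"
    if "finite S" "siegprod S (r, t) \<i> \<noteq> 0" "Phi_ord r \<le> (\<Sum>s\<in>S. cuspord (s * r)) - 7200" for S
  proof -
    have "(\<lambda>\<tau>. 1 / siegprod S (r, t) \<tau>) \<in>
        O[at_icusp](\<lambda>\<tau>. ee (of_int ((\<Sum>s\<in>S. cuspord (s * r)) - 7200) / 120 * \<tau> / 60))"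
      by (rule inverse_siegprod_bigo[of \<i>]) (use that in auto)
    also have "(\<lambda>\<tau>. ee (of_int ((\<Sum>s\<in>S. cuspord (s * r)) - 7200) / 120 * \<tau> / 60)) =
        (\<lambda>\<tau>. ee (of_real (real_of_int ((\<Sum>s\<in>S. cuspord (s * r)) - 7200) / 120) * \<tau> / 60))"
      by simp
    also have "\<dots> \<in> O[at_icusp](?g)"
      by (intro ee_bigo_mono divide_right_mono of_int_le_iff[THEN iffD2] that(3)) simp
    finally show ?thesis .
  qed
  have "(\<lambda>\<tau>. 1 / siegprod resS (r, t) \<tau>) \<in> O[at_icusp](?g)"
    by (rule *) (use siegprod_res_nonzero[OF v, of \<i>] in \<open>auto simp only: Phi_ord_def imaginary_unit.sel finite.intros\<close>)
  moreover have "(\<lambda>\<tau>. 1 / siegprod resT (r, t) \<tau>) \<in> O[at_icusp](?g)"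
    by (rule *) (use siegprod_res_nonzero[OF v, of \<i>] in \<open>auto simp only: Phi_ord_def imaginary_unit.sel finite.intros\<close>)
  moreover have "(\<lambda>_. 1) \<in> O[at_icusp](?g)"
    using ee_bigo_mono[of "real_of_int (Phi_ord r) / 120" 0] by (simp add: Phi_ord_def)
  ultimately show ?thesis
    unfolding Phi_def [abs_def] by (intro sum_in_bigo)
qed

text \<open>\<open>Phi (1, t)\<close> is the translate of \<open>Phi (1, 0)\<close> by t, and a real
  translation changes the comparison function only by a constant factor.\<close>

lemma Phi_1_bigo:
  assumes "Phi (1, 0) \<in> O[at_icusp](\<lambda>\<tau>. ee (of_real 76 * \<tau> / 60))" and "t \<in> {0..<60}"
  shows "Phi (1, t) \<in> O[at_icusp](\<lambda>\<tau>. ee (of_real 76 * \<tau> / 60))"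
proof -
  define n where "n = nat t"
  have t: "t = int n mod 60" using assms(2) by (simp add: n_def)
  have "filterlim (\<lambda>\<tau>. \<tau> + of_nat n) at_icusp at_icusp"
    unfolding filterlim_filtercomap_iff by (simp add: o_def filterlim_filtercomap)
  from landau_o.big.compose[OF assms(1) this]
  have "(\<lambda>\<tau>. Phi (1, 0) (\<tau> + of_nat n)) \<in> O[at_icusp](\<lambda>\<tau>. ee (of_real 76 * (\<tau> + of_nat n) / 60))" .
  also have "(\<lambda>\<tau>. ee (of_real 76 * (\<tau> + of_nat n) / 60)) =
      (\<lambda>\<tau>. ee (of_real 76 * of_nat n / 60) * ee (of_real 76 * \<tau> / 60))"
    unfolding ee_add [symmetric] by (intro ext arg_cong[of _ _ ee]) (simp add: add_divide_distrib ring_distribs)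
  finally have A: "(\<lambda>\<tau>. Phi (1, 0) (\<tau> + of_nat n)) \<in> O[at_icusp](\<lambda>\<tau>. ee (of_real 76 * \<tau> / 60))"
    by (subst (asm) landau_o.big.cmult) auto
  have B: "eventually (\<lambda>\<tau>. Phi (1, 0) (\<tau> + of_nat n) = Phi (1, t) \<tau>) at_icusp"
    by (intro eventually_mono[OF eventually_icusp_upper]) (simp add: Phi_T_power t)
  show ?thesis
    by (rule iffD1[OF landau_o.big.in_cong[OF B] A])
qed

text \<open>Since 59 is -1 modulo 60, evenness in the characteristic transfers the bound from
  \<open>(1, - t)\<close>; the high order of vanishing is thus gained twice for every
  \<open>t\<close>.\<close>

lemma Phi_59_bigo:
  assumes "Phi (1, 0) \<in> O[at_icusp](\<lambda>\<tau>. ee (of_real 76 * \<tau> / 60))" and "t \<in> {0..<60}"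
  shows "Phi (59, t) \<in> O[at_icusp](\<lambda>\<tau>. ee (of_real 76 * \<tau> / 60))"
proof -
  have "Phi (59, t) \<tau> = Phi (1, (- t) mod 60) \<tau>" if "Im \<tau> > 0" for \<tau>
    using Phi_uminus[OF that, of 1 "(- t) mod 60"] assms(2) by (simp add: mod_simps)
  hence B: "eventually (\<lambda>\<tau>. Phi (1, (- t) mod 60) \<tau> = Phi (59, t) \<tau>) at_icusp"
    by (intro eventually_mono[OF eventually_icusp_upper]) simp
  have A: "Phi (1, (- t) mod 60) \<in> O[at_icusp](\<lambda>\<tau>. ee (of_real 76 * \<tau> / 60))"
    by (rule Phi_1_bigo[OF assms(1)]) simp
  show ?thesis
    by (rule iffD1[OF landau_o.big.in_cong[OF B] A])
qed

text \<open>\<open>9120 = 120 * 76\<close> encodes that \<open>Phi (1, 0)\<close> vanishes to order 76, which outweighs all poles.\<close>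

definition total_ord :: "int \<Rightarrow> int" where
  "total_ord r = (if r = 1 \<or> r = 59 then 9120 else Phi_ord r)"

text \<open>The entries 1 and 59 give 2 * 9120 = 18240; the 58 others sum to -18000 = -120 * 150.
  With 75 in place of 76 the total would be exactly 0 and force no decay.\<close>

lemma total_ord_sum: "(\<Sum>r\<in>{0..<60}. total_ord r) = 240"
proof -
  have "(\<Sum>r\<in>{0..<60}. total_ord r) = sum_list (map total_ord [0..59])"
    by (subst sum_list_distinct_conv_sum_set) (auto intro!: sum.cong)
  also have "\<dots> = 240"
    by code_simp
  finally show ?thesis .
qed

lemma orbit_1: "t \<in> {0..<60} \<Longrightarrow> (1, t) \<in> orbit"
  using orbit_T_int[OF orbit_base, of t] by simp

lemma orbit_59:
  assumes "t \<in> {0..<60}" shows "(59, t) \<in> orbit"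
proof -
  have "(59, 0) \<in> orbit" using orbit_S[OF orbit_S[OF orbit_base]] by simp
  from orbit_T_int[OF this, of "- t"] have "(59, (0 + - t * 59) mod 60) \<in> orbit" .
  also have "0 + - t * 59 = t + 60 * (- t)" by simp
  also have "(t + 60 * (- t)) mod 60 = t" using assms by (simp only: mod_mult_self2) simp
  finally show ?thesis .
qed

text \<open>Summing over all 60 * 60 pairs, 14400 = 60 * 240, avoids determining the orbit: it
  contains every pair with first entry 1 or 59, and the pairs outside it contribute nonpositive
  terms.\<close>

lemma total_ord_orbit_sum: "(\<Sum>v\<in>orbit. total_ord (fst v)) \<ge> 14400"
proof -
  define Box :: "(int \<times> int) set" where "Box = {0..<60} \<times> {0..<60}"
  have "(\<Sum>v\<in>Box. total_ord (fst v)) = (\<Sum>r\<in>{0..<60}. \<Sum>t\<in>{0..<60::int}. total_ord r)"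
    by (simp only: Box_def sum.cartesian_product case_prod_unfold)
  also have "\<dots> = 14400"
    by (simp add: sum_distrib_left [symmetric] total_ord_sum)
  finally have "14400 = (\<Sum>v\<in>orbit. total_ord (fst v)) + (\<Sum>v\<in>Box - orbit. total_ord (fst v))"
    using sum.subset_diff[of orbit Box "\<lambda>v. total_ord (fst v)"] orbit_subset by (simp add: Box_def)
  moreover have "(\<Sum>v\<in>Box - orbit. total_ord (fst v)) \<le> 0"
    by (intro sum_nonpos) (auto simp: total_ord_def Phi_ord_def Box_def orbit_1 orbit_59)
  ultimately show ?thesis by linarith
qed

lemma Phi_orbit_eq_0:
  assumes Phi10: "Phi (1, 0) \<in> O[at_icusp](\<lambda>\<tau>. ee (of_real 76 * \<tau> / 60))"
    and v: "(r, t) \<in> orbit" and \<tau>: "Im \<tau> > 0"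
  shows "Phi (r, t) \<tau> = 0"
proof -
  define F where "F = (\<lambda>\<tau>. \<Prod>v\<in>orbit. Phi v \<tau>)"
  have hol: "Phi v holomorphic_on upper" if "v \<in> orbit" for v
    using holomorphic_Phi that by (cases v) auto
  have bigo: "Phi v \<in> O[at_icusp](\<lambda>\<tau>. ee (of_real (real_of_int (total_ord (fst v)) / 120) * \<tau> / 60))"
    if "v \<in> orbit" for v
    using Phi_bigo Phi_1_bigo[OF Phi10] Phi_59_bigo[OF Phi10] orbit_range that
    by (cases v) (auto simp: total_ord_def)
  have "F \<in> O[at_icusp](\<lambda>\<tau>. \<Prod>v\<in>orbit. ee (of_real (real_of_int (total_ord (fst v)) / 120) * \<tau> / 60))"
    unfolding F_def by (intro landau_o.big_prod bigo)
  also have "(\<lambda>\<tau>. \<Prod>v\<in>orbit. ee (of_real (real_of_int (total_ord (fst v)) / 120) * \<tau> / 60)) =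
      (\<lambda>\<tau>. ee (of_real (real_of_int (\<Sum>v\<in>orbit. total_ord (fst v)) / 120) * \<tau> / 60))"
    unfolding ee_sum [symmetric] by (simp add: sum_divide_distrib sum_distrib_right)
  \<comment> \<open>The exponent is at least 14400 / 120 = 120; exponent 1 already gives decay at
    the cusp.\<close>
  also have "\<dots> \<in> O[at_icusp](\<lambda>\<tau>. ee (of_real 1 * \<tau> / 60))"
    using total_ord_orbit_sum by (intro ee_bigo_mono) linarith
  also have "(\<lambda>\<tau>. ee (of_real 1 * \<tau> / 60)) \<in> o[at_icusp](\<lambda>_. 1)"
    using tendsto_ee_icusp by (intro smalloI_tendsto) auto
  finally have lim: "(F \<longlongrightarrow> 0) at_icusp"
    by (auto dest: smalloD_tendsto)
  have "F z = 0" if "z \<in> upper" for z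
  proof (rule modular_function_eq_0[OF _ _ _ lim])
    show "F holomorphic_on upper"
      unfolding F_def by (intro holomorphic_intros hol)
    fix \<sigma> :: complex assume \<sigma>: "Im \<sigma> > 0"
    have "F (\<sigma> + 1) = (\<Prod>v\<in>orbit. Phi (case v of (r, t) \<Rightarrow> (r, (r + t) mod 60)) \<sigma>)"
      unfolding F_def using \<sigma> by (intro prod.cong) (auto simp: Phi_T)
    also have "\<dots> = F \<sigma>"
      unfolding F_def by (rule prod.reindex_bij_betw[OF bij_betw_orbit_T])
    finally show "F (\<sigma> + 1) = F \<sigma>" .
    have "F (- 1 / \<sigma>) = (\<Prod>v\<in>orbit. Phi (case v of (r, t) \<Rightarrow> (t, (- r) mod 60)) \<sigma>)"
      unfolding F_def using \<sigma> by (intro prod.cong) (auto simp: Phi_S simp del: minus_divide_left)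
    also have "\<dots> = F \<sigma>"
      unfolding F_def by (rule prod.reindex_bij_betw[OF bij_betw_orbit_S])
    finally show "F (- 1 / \<sigma>) = F \<sigma>" .
  qed (use that in auto)
  hence "\<exists>v\<in>orbit. \<forall>z\<in>upper. Phi v z = 0"
    unfolding F_def
    by (intro prod_eq_0_imp_factor_eq_0 finite_orbit open_upper connected_upper hol)
       (auto intro!: exI[of _ \<i>])
  then obtain r' t' where v': "(r', t') \<in> orbit" and zero: "\<And>z. Im z > 0 \<Longrightarrow> Phi (r', t') z = 0"
    by auto
  \<comment> \<open>Vanishing is traced back from the unknown characteristic to
    \<open>(1, 0)\<close> by undoing each generator, with z - 1 for the translation and -1/z for the
    inversion; afterwards it is spread forward over the whole orbit.\<close>
  from v' have "(\<forall>z. Im z > 0 \<longrightarrow> Phi (r', t') z = 0) \<longrightarrow> (\<forall>z. Im z > 0 \<longrightarrow> Phi (1, 0) z = 0)"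
  proof (induction rule: orbit.induct)
    case (orbit_T r t)
    have "Phi (r, t) z = 0" if "\<forall>z. Im z > 0 \<longrightarrow> Phi (r, (r + t) mod 60) z = 0" "Im z > 0" for z
      using that Phi_T[of "z - 1" r t] by simp
    thus ?case using orbit_T.IH by blast
  next
    case (orbit_S r t)
    have "Phi (r, t) z = 0" if "\<forall>z. Im z > 0 \<longrightarrow> Phi (t, (- r) mod 60) z = 0" "Im z > 0" for z
    proof -
      have "z \<noteq> 0" using that by auto
      thus ?thesis
        using that Phi_S[OF upper_inversion, of z t r] upper_inversion[of z] by simp
    qed
    thus ?case using orbit_S.IH by blast
  qed simp
  with zero have base: "Phi (1, 0) z = 0" if "Im z > 0" for z
    using that by blast
  from v \<tau> show ?thesis
  proof (induction arbitrary: \<tau> rule: orbit.induct)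
    case (orbit_T r t \<tau>)
    thus ?case using Phi_T by simp
  next
    case (orbit_S r t \<tau>)
    thus ?case using Phi_S upper_inversion by simp
  qed (use base in auto)
qed

section \<open>Generating functions of partitions\<close>

definition parts_of :: "nat set \<Rightarrow> nat \<Rightarrow> nat multiset set" where
  "parts_of A n = {P. set_mset P \<subseteq> A \<and> sum_mset P = n}"

lemma num_partitions_conv: "num_partitions A n = card (parts_of A n)"
  by (simp add: num_partitions_def parts_of_def)

lemma parts_of_restrict:
  assumes "n \<le> N"
  shows "parts_of (A \<inter> {..N}) n = parts_of A n"
proof -
  have "x \<le> N" if "x \<in># P" "sum_mset P = n" for x P
  proof -
    obtain Q where "P = add_mset x Q" using \<open>x \<in># P\<close> by (meson multi_member_split)
    thus ?thesis using that assms by auto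
  qed
  thus ?thesis unfolding parts_of_def by blast
qed

lemma num_partitions_restrict: "n \<le> N \<Longrightarrow> num_partitions (A \<inter> {..N}) n = num_partitions A n"
  by (simp add: num_partitions_conv parts_of_restrict)

text \<open>A partition either does not use k, or it loses one copy of k and may still contain
  others; hence \<open>insert k A\<close> on both sides.\<close>

lemma parts_of_insert:
  assumes "k \<notin> A"
  shows "parts_of (insert k A) n =
           parts_of A n \<union> (if k \<le> n then add_mset k ` parts_of (insert k A) (n - k) else {})"
proof (intro set_eqI iffI)
  fix P assume P: "P \<in> parts_of (insert k A) n"
  show "P \<in> parts_of A n \<union> (if k \<le> n then add_mset k ` parts_of (insert k A) (n - k) else {})"
  proof (cases "k \<in># P")
    case True
    then obtain Q where Q: "P = add_mset k Q" by (meson multi_member_split)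
    hence "Q \<in> parts_of (insert k A) (n - k)" "k \<le> n" using P by (auto simp: parts_of_def)
    thus ?thesis using Q by auto
  qed (use P in \<open>auto simp: parts_of_def\<close>)
qed (auto simp: parts_of_def split: if_splits)

lemma finite_parts_of:
  assumes "0 \<notin> A"
  shows "finite (parts_of A n)"
proof -
  have "finite (parts_of B n)" if "finite B" "0 \<notin> B" for B n
    using that
  proof (induction B arbitrary: n)
    case empty
    have "parts_of {} n \<subseteq> {{#}}" by (auto simp: parts_of_def)
    thus ?case by (rule finite_subset) auto
  next
    case (insert k B)
    show ?case
    proof (induction n rule: less_induct)
      case (less n)
      show ?case
        using insert less by (subst parts_of_insert[OF insert.hyps(2)]) auto
    qed
  qed
  from this[of "A \<inter> {..n}" n] assms show ?thesis
    by (simp add: parts_of_restrict)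
qed

lemma num_partitions_insert:
  assumes "k \<notin> A" "0 \<notin> A" "k > 0"
  shows "num_partitions (insert k A) n =
           num_partitions A n + (if k \<le> n then num_partitions (insert k A) (n - k) else 0)"
proof -
  have "card (add_mset k ` parts_of (insert k A) (n - k)) = card (parts_of (insert k A) (n - k))"
    by (intro card_image) (auto simp: inj_on_def)
  moreover have "parts_of A n \<inter> add_mset k ` parts_of (insert k A) (n - k) = {}"
  proof (rule equals0I)
    fix P assume P: "P \<in> parts_of A n \<inter> add_mset k ` parts_of (insert k A) (n - k)"
    then obtain Q where "P = add_mset k Q" by blast
    moreover have "set_mset P \<subseteq> A" using P by (simp add: parts_of_def)
    ultimately show False using assms(1) by simp
  qed
  moreover have "finite (parts_of A n)" "finite (add_mset k ` parts_of (insert k A) (n - k))"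
    using assms by (simp_all add: finite_parts_of)
  ultimately have "card (parts_of A n \<union> add_mset k ` parts_of (insert k A) (n - k)) =
      card (parts_of A n) + card (parts_of (insert k A) (n - k))"
    by (simp add: card_Un_disjoint)
  thus ?thesis
    unfolding num_partitions_conv by (subst parts_of_insert[OF assms(1), of n]) simp
qed

lemma num_partitions_empty: "num_partitions {} n = (if n = 0 then 1 else 0)"
proof -
  have "parts_of {} n = (if n = 0 then {{#}} else {})"
    by (auto simp: parts_of_def)
  thus ?thesis by (simp add: num_partitions_conv)
qed

lemma num_partitions_mono:
  assumes "A \<subseteq> B" "0 \<notin> B"
  shows "num_partitions A n \<le> num_partitions B n"
  unfolding num_partitions_conv
  by (rule card_mono[OF finite_parts_of[OF assms(2)]]) (use assms in \<open>auto simp: parts_of_def\<close>)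

section \<open>Convergence of partition series and their products\<close>

definition part_gf :: "nat set \<Rightarrow> complex \<Rightarrow> complex" where
  "part_gf A q = (\<Sum>n. of_nat (num_partitions A n) * q ^ n)"

lemma sums_shifted:
  fixes f :: "nat \<Rightarrow> 'a::real_normed_vector"
  assumes "f sums s"
  shows "(\<lambda>n. if k \<le> n then f (n - k) else 0) sums s"
proof -
  have "(\<lambda>i. if k \<le> i + k then f (i + k - k) else 0) sums s"
    using assms by simp
  thus ?thesis
    by (subst (asm) sums_zero_iff_shift) auto
qed

text \<open>With nonnegative terms, bounded partial sums give summability: the recurrence bounds a
  partial sum B by P + x^k B, where P is the product for \<open>A\<close>. The sum then solves s = P
  + x^k s.\<close>

lemma finite_partition_gf_real:
  fixes x :: real
  assumes "finite A" "0 \<notin> A" "0 \<le> x" "x < 1"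
  shows "(\<lambda>n. real (num_partitions A n) * x ^ n) sums (\<Prod>k\<in>A. 1 / (1 - x ^ k))"
  using assms(1,2)
proof (induction A)
  case empty
  have "(\<lambda>n. if n = 0 then (1::real) else 0) sums 1"
    using sums_single[of 0 "\<lambda>_. 1::real"] by simp
  also have "(\<lambda>n. if n = 0 then (1::real) else 0) = (\<lambda>n. real (num_partitions {} n) * x ^ n)"
    by (auto simp: num_partitions_empty)
  finally show ?case by simp
next
  case (insert k A)
  define a where "a = (\<lambda>n. real (num_partitions A n) * x ^ n)"
  define b where "b = (\<lambda>n. real (num_partitions (insert k A) n) * x ^ n)"
  have k: "k > 0" using insert by auto
  hence xk: "x ^ k < 1" "x ^ k \<ge> 0"
    using assms by (auto simp: power_less_one_iff)
  have a: "a sums (\<Prod>k\<in>A. 1 / (1 - x ^ k))"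
    unfolding a_def using insert by auto
  have nonneg: "a n \<ge> 0" "b n \<ge> 0" for n
    using assms by (auto simp: a_def b_def)
  have rec: "b n = a n + (if k \<le> n then x ^ k * b (n - k) else 0)" for n
    using num_partitions_insert[of k A n] insert k
    by (auto simp: a_def b_def algebra_simps power_add [symmetric])
  have "summable b"
  proof (rule summableI_nonneg_bounded)
    fix N
    have "(\<Sum>n<N. if k \<le> n then b (n - k) else 0) \<le> (\<Sum>n<N. b n)"
    proof -
      have "(\<Sum>n<N. if k \<le> n then b (n - k) else 0) = (\<Sum>n\<in>{k..<N}. b (n - k))"
        by (intro sum.mono_neutral_cong_right) auto
      also have "\<dots> = (\<Sum>n<N - k. b n)"
        by (rule sum.reindex_bij_witness[of _ "\<lambda>n. n + k" "\<lambda>n. n - k"]) auto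
      also have "\<dots> \<le> (\<Sum>n<N. b n)"
        by (intro sum_mono2) (auto simp: nonneg)
      finally show ?thesis .
    qed
    hence "x ^ k * (\<Sum>n<N. if k \<le> n then b (n - k) else 0) \<le> x ^ k * (\<Sum>n<N. b n)"
      using xk by (intro mult_left_mono)
    moreover have "(\<Sum>n<N. b n) = (\<Sum>n<N. a n) + x ^ k * (\<Sum>n<N. if k \<le> n then b (n - k) else 0)"
    proof -
      have "(\<Sum>n<N. b n) = (\<Sum>n<N. a n + x ^ k * (if k \<le> n then b (n - k) else 0))"
        by (intro sum.cong refl, subst rec) simp
      thus ?thesis by (simp only: sum.distrib sum_distrib_left)
    qed
    moreover have "(\<Sum>n<N. a n) \<le> (\<Prod>k\<in>A. 1 / (1 - x ^ k))"
      using a sum_le_suminf[of a "{..<N}"] by (auto simp: sums_iff nonneg)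
    ultimately have "(\<Sum>n<N. b n) * (1 - x ^ k) \<le> (\<Prod>k\<in>A. 1 / (1 - x ^ k))"
      by (simp add: algebra_simps)
    thus "(\<Sum>n<N. b n) \<le> (\<Prod>k\<in>A. 1 / (1 - x ^ k)) / (1 - x ^ k)"
      using xk by (simp add: field_simps)
  qed (simp add: nonneg)
  then obtain s where s: "b sums s" by blast
  have "(\<lambda>n. a n + x ^ k * (if k \<le> n then b (n - k) else 0)) sums ((\<Prod>k\<in>A. 1 / (1 - x ^ k)) + x ^ k * s)"
    by (intro sums_add a sums_mult sums_shifted s)
  also have "(\<lambda>n. a n + x ^ k * (if k \<le> n then b (n - k) else 0)) = b"
    by (intro ext, subst (2) rec) simp
  finally have "s = (\<Prod>k\<in>A. 1 / (1 - x ^ k)) + x ^ k * s"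
    using s sums_unique2 by blast
  hence "s = (\<Prod>k\<in>A. 1 / (1 - x ^ k)) / (1 - x ^ k)"
    using xk by (simp add: field_simps)
  thus ?case using s insert.hyps by (simp add: b_def)
qed

text \<open>The real case at \<open>norm q\<close> provides absolute convergence, after which the
  same recurrence determines the sum.\<close>

lemma finite_partition_gf:
  fixes q :: complex
  assumes "finite A" "0 \<notin> A" "norm q < 1"
  shows "(\<lambda>n. of_nat (num_partitions A n) * q ^ n) sums (\<Prod>k\<in>A. 1 / (1 - q ^ k))"
  using assms(1,2)
proof (induction A)
  case empty
  have "(\<lambda>n. if n = 0 then (1::complex) else 0) sums 1"
    using sums_single[of 0 "\<lambda>_. 1::complex"] by simp
  also have "(\<lambda>n. if n = 0 then (1::complex) else 0) = (\<lambda>n. of_nat (num_partitions {} n) * q ^ n)"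
    by (auto simp: num_partitions_empty)
  finally show ?case by simp
next
  case (insert k A)
  define a where "a = (\<lambda>n. of_nat (num_partitions A n) * q ^ n)"
  define b where "b = (\<lambda>n. of_nat (num_partitions (insert k A) n) * q ^ n)"
  have k: "k > 0" using insert by auto
  have qk: "q ^ k \<noteq> 1"
  proof
    assume "q ^ k = 1"
    hence "norm q ^ k = 1" by (metis norm_one norm_power)
    moreover have "norm q ^ k < 1" using assms(3) k by (simp add: power_less_one_iff)
    ultimately show False by simp
  qed
  have a: "a sums (\<Prod>k\<in>A. 1 / (1 - q ^ k))"
    unfolding a_def using insert by auto
  have rec: "b n = a n + (if k \<le> n then q ^ k * b (n - k) else 0)" for n
    using num_partitions_insert[of k A n] insert k
    by (auto simp: a_def b_def algebra_simps power_add [symmetric])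
  have "summable b"
    unfolding b_def by (rule summable_norm_cancel)
      (use finite_partition_gf_real[of "insert k A" "norm q"] insert assms(3) in
        \<open>auto simp: norm_mult norm_power sums_iff\<close>)
  then obtain s where s: "b sums s" by blast
  have "(\<lambda>n. a n + q ^ k * (if k \<le> n then b (n - k) else 0)) sums ((\<Prod>k\<in>A. 1 / (1 - q ^ k)) + q ^ k * s)"
    by (intro sums_add a sums_mult sums_shifted s)
  also have "(\<lambda>n. a n + q ^ k * (if k \<le> n then b (n - k) else 0)) = b"
    by (intro ext, subst (2) rec) simp
  finally have "s = (\<Prod>k\<in>A. 1 / (1 - q ^ k)) + q ^ k * s"
    using s sums_unique2 by blast
  hence "s = (\<Prod>k\<in>A. 1 / (1 - q ^ k)) / (1 - q ^ k)"
    using qk by (simp add: field_simps)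
  thus ?case using s insert.hyps by (simp add: b_def)
qed

text \<open>Partial sums see only finitely many parts, and the finite products are bounded
  uniformly: 1/(1 - x^k) \<le> exp(x^k/(1 - x)), and the exponents add up to at most a geometric
  series.\<close>

lemma summable_partition_gf_real:
  fixes x :: real
  assumes "0 \<notin> A" "0 \<le> x" "x < 1"
  shows "summable (\<lambda>n. real (num_partitions A n) * x ^ n)"
proof (rule summableI_nonneg_bounded)
  fix N
  define B where "B = A \<inter> {..N}"
  have B: "finite B" "0 \<notin> B" using assms by (auto simp: B_def)
  have "(\<Sum>n<N. real (num_partitions A n) * x ^ n) = (\<Sum>n<N. real (num_partitions B n) * x ^ n)"
    by (intro sum.cong) (auto simp: B_def num_partitions_restrict)
  also have "\<dots> \<le> (\<Prod>k\<in>B. 1 / (1 - x ^ k))"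
    using finite_partition_gf_real[OF B assms(2,3)] assms
      sum_le_suminf[of "\<lambda>n. real (num_partitions B n) * x ^ n" "{..<N}"] by (auto simp: sums_iff)
  also have "\<dots> \<le> (\<Prod>k\<in>B. exp (x ^ k / (1 - x)))"
  proof (intro prod_mono conjI)
    fix k assume "k \<in> B"
    hence k: "k > 0" using B by (auto intro: gr0I)
    hence xk: "x ^ k < 1" "x ^ k \<ge> 0" "x ^ k \<le> x"
      using assms by (auto simp: power_less_one_iff intro: power_le_one_iff power_decreasing[of 1 k x, simplified])
    thus "0 \<le> 1 / (1 - x ^ k)" by simp
    have "1 / (1 - x ^ k) = 1 + x ^ k / (1 - x ^ k)"
      using xk by (simp add: field_simps)
    also have "\<dots> \<le> 1 + x ^ k / (1 - x)"
      using xk assms by (intro add_left_mono divide_left_mono) (auto intro!: mult_pos_pos)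
    also have "\<dots> \<le> exp (x ^ k / (1 - x))"
      by (rule exp_ge_add_one_self)
    finally show "1 / (1 - x ^ k) \<le> exp (x ^ k / (1 - x))" .
  qed
  also have "\<dots> = exp ((\<Sum>k\<in>B. x ^ k) / (1 - x))"
    using B by (simp add: exp_sum sum_divide_distrib)
  also have "(\<Sum>k\<in>B. x ^ k) \<le> (\<Sum>k. x ^ k)"
    using assms B by (intro sum_le_suminf summable_geometric) auto
  hence "exp ((\<Sum>k\<in>B. x ^ k) / (1 - x)) \<le> exp ((\<Sum>k. x ^ k) / (1 - x))"
    using assms by (simp add: divide_right_mono)
  finally show "(\<Sum>n<N. real (num_partitions A n) * x ^ n) \<le> exp ((\<Sum>k. x ^ k) / (1 - x))" .
qed (use assms in auto)

lemma summable_part_gf: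
  fixes q :: complex
  assumes "0 \<notin> A" "norm q < 1"
  shows "summable (\<lambda>n. of_nat (num_partitions A n) * q ^ n)"
  by (rule summable_norm_cancel)
     (use summable_partition_gf_real[OF assms(1), of "norm q"] assms(2) in \<open>auto simp: norm_mult norm_power\<close>)

text \<open>Tannery's theorem, with the series for the whole set \<open>A\<close> at
  \<open>norm q\<close> as majorant; each coefficient is eventually constant in N.\<close>

lemma part_gf_LIMSEQ:
  assumes A: "0 \<notin> A" and q: "norm q < 1"
  shows "(\<lambda>N. \<Prod>k\<in>A \<inter> {..N}. 1 / (1 - q ^ k)) \<longlonglongrightarrow> part_gf A q"
proof -
  have *: "(\<Prod>k\<in>A \<inter> {..N}. 1 / (1 - q ^ k)) = (\<Sum>n. of_nat (num_partitions (A \<inter> {..N}) n) * q ^ n)" for N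
    using finite_partition_gf[of "A \<inter> {..N}" q] A q by (simp add: sums_iff)
  show ?thesis
    unfolding * part_gf_def
  proof (rule tannerys_theorem[THEN conjunct2, THEN conjunct2])
    show "(\<lambda>N. of_nat (num_partitions (A \<inter> {..N}) n) * q ^ n) \<longlonglongrightarrow> of_nat (num_partitions A n) * q ^ n" for n
      by (intro tendsto_eventually eventually_sequentiallyI[of n]) (simp add: num_partitions_restrict)
    show "\<forall>\<^sub>F (n, N) in at_top \<times>\<^sub>F sequentially. norm (of_nat (num_partitions (A \<inter> {..N}) n) * q ^ n)
        \<le> real (num_partitions A n) * norm q ^ n"
      by (intro always_eventually)
         (auto simp: norm_mult norm_power intro!: mult_right_mono num_partitions_mono A)
    show "summable (\<lambda>n. real (num_partitions A n) * norm q ^ n)"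
      using A q by (intro summable_partition_gf_real) auto
  qed auto
qed

lemma prod_residue_class:
  fixes q :: complex
  assumes R: "R \<subseteq> {0<..<60::nat}" and M: "M > 0"
  shows "(\<Prod>k\<in>{n. n mod 60 \<in> R} \<inter> {..60 * M - 1}. 1 - q ^ k) = (\<Prod>s\<in>R. \<Prod>n<M. 1 - q ^ s * (q ^ 60) ^ n)"
proof -
  have "(\<Prod>s\<in>R. \<Prod>n<M. 1 - q ^ s * (q ^ 60) ^ n) = (\<Prod>(s, n)\<in>R \<times> {..<M}. 1 - q ^ s * (q ^ 60) ^ n)"
    by (rule prod.cartesian_product)
  \<comment> \<open>Cutting at \<open>60 * M - 1\<close> gives every residue class in
    \<open>R\<close> exactly M terms; as 0 is not in \<open>R\<close>, the part 0 does not
    occur.\<close>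
  also have "\<dots> = (\<Prod>k\<in>{n. n mod 60 \<in> R} \<inter> {..60 * M - 1}. 1 - q ^ k)"
  proof (rule prod.reindex_bij_witness[of _ "\<lambda>k. (k mod 60, k div 60)" "\<lambda>(s, n). s + 60 * n"], goal_cases)
    case (2 a)
    then obtain s n where a: "a = (s, n)" "s \<in> R" "n < M" by auto
    hence "s < 60" using R by auto
    have "60 * n + 60 \<le> 60 * M" using a by linarith
    hence "s + 60 * n \<le> 60 * M - 1" using \<open>s < 60\<close> by linarith
    thus ?case using a \<open>s < 60\<close> by simp
  next
    case (4 k)
    hence "k < M * 60" using M by auto
    hence "k div 60 < M" by (simp add: less_mult_imp_div_less)
    thus ?case using 4 by auto
  qed (use R in \<open>auto simp: power_add power_mult\<close>)
  finally show ?thesis ..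
qed

text \<open>The finite products are reciprocal to each other, and the limit of this relation in
  product form gives the nonvanishing of the infinite product along with its reciprocal.\<close>

lemma part_gf_residue_class:
  assumes R: "R \<subseteq> {0<..<60::nat}" and q: "norm q < 1"
  shows "part_gf {n. n mod 60 \<in> R} q * (\<Prod>s\<in>R. qprod (q ^ s) (q ^ 60)) = 1"
proof -
  define A where "A = {n. n mod 60 \<in> R}"
  have A0: "0 \<notin> A" using R by (auto simp: A_def)
  have q60: "norm (q ^ 60) < 1" using q by (simp add: norm_power power_less_one_iff)
  have "strict_mono (\<lambda>M. 60 * Suc M - 1)" by (auto simp: strict_mono_def)
  from LIMSEQ_subseq_LIMSEQ[OF part_gf_LIMSEQ[OF A0 q] this]
  have lim1: "(\<lambda>M. \<Prod>k\<in>A \<inter> {..60 * Suc M - 1}. 1 / (1 - q ^ k)) \<longlonglongrightarrow> part_gf A q"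
    by (simp only: o_def)
  have lim2: "(\<lambda>M. \<Prod>s\<in>R. \<Prod>n<Suc M. 1 - q ^ s * (q ^ 60) ^ n) \<longlonglongrightarrow> (\<Prod>s\<in>R. qprod (q ^ s) (q ^ 60))"
    by (intro tendsto_prod filterlim_compose[OF qprod_LIMSEQ[OF q60] filterlim_Suc])
  have nz: "1 - q ^ k \<noteq> 0" if "k \<in> A" for k
  proof
    assume "1 - q ^ k = 0"
    hence "norm q ^ k = 1" by (metis eq_iff_diff_eq_0 norm_one norm_power)
    moreover have "k > 0" using that A0 by (auto intro: gr0I)
    ultimately show False using q power_less_one_iff[of "norm q" k] by simp
  qed
  have "(\<Prod>k\<in>A \<inter> {..60 * Suc M - 1}. 1 / (1 - q ^ k)) * (\<Prod>s\<in>R. \<Prod>n<Suc M. 1 - q ^ s * (q ^ 60) ^ n) = 1" for M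
  proof -
    have "(\<Prod>k\<in>A \<inter> {..60 * Suc M - 1}. 1 / (1 - q ^ k)) * (\<Prod>k\<in>A \<inter> {..60 * Suc M - 1}. 1 - q ^ k) = 1"
      unfolding prod.distrib [symmetric] by (intro prod.neutral) (use nz in auto)
    thus ?thesis unfolding A_def prod_residue_class[OF R zero_less_Suc] .
  qed
  with tendsto_mult[OF lim1 lim2] have "(\<lambda>M::nat. 1) \<longlonglongrightarrow> part_gf A q * (\<Prod>s\<in>R. qprod (q ^ s) (q ^ 60))"
    by simp
  thus ?thesis
    unfolding A_def by (simp add: LIMSEQ_const_iff)
qed

lemma pm_residues_60:
  assumes "R \<subseteq> {0<..<30}"
  shows "pm_residues R 60 = {n. n mod 60 \<in> nat ` R \<union> (\<lambda>r. nat (60 - r)) ` R}"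
proof -
  have 1: "[int n = r] (mod 60) \<longleftrightarrow> n mod 60 = nat r" if "0 < r" "r < 30" for n r
    using that by (auto simp: Cong.cong_def zmod_int nat_eq_iff2)
  have 2: "[int n = - r] (mod 60) \<longleftrightarrow> n mod 60 = nat (60 - r)" if "0 < r" "r < 30" for n r
  proof -
    have "(- r) mod 60 = (- r + 60) mod 60" by (rule mod_add_self2 [symmetric])
    also have "\<dots> = 60 - r" using that by (subst mod_pos_pos_trivial) auto
    finally have "[int n = - r] (mod 60) \<longleftrightarrow> int n mod 60 = 60 - r"
      by (simp add: Cong.cong_def)
    thus ?thesis using that by (auto simp: zmod_int nat_eq_iff2)
  qed
  have 3: "n > 0" if "n mod 60 \<in> nat ` R \<union> (\<lambda>r. nat (60 - r)) ` R" for n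
    using that assms by (intro gr0I) auto
  show ?thesis
    unfolding pm_residues_def using assms 1 2 3 by (fastforce simp: subset_iff)
qed

text \<open>For 0 < s < 30 the classes s and 60 - s are distinct, and their two products are the two
  factors of \<open>jac (q ^ s) (q ^ 60)\<close>.\<close>

lemma part_gf_pm_residues:
  assumes R: "R \<subseteq> {0<..<30}" and q: "norm q < 1" "q \<noteq> 0"
  shows "part_gf (pm_residues R 60) q * (\<Prod>s\<in>R. jac (q ^ nat s) (q ^ 60)) = 1"
proof -
  have fin: "finite R" using R finite_subset by blast
  have disj: "nat ` R \<inter> (\<lambda>r. nat (60 - r)) ` R = {}"
  proof (rule equals0I)
    fix x assume "x \<in> nat ` R \<inter> (\<lambda>r. nat (60 - r)) ` R"
    then obtain r r' where r: "r \<in> R" "r' \<in> R" "x = nat r" "x = nat (60 - r')" by auto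
    hence "r \<in> {0<..<30}" "r' \<in> {0<..<30}" using R by auto
    hence "int x = r" "int x = 60 - r'" using r by auto
    with \<open>r \<in> {0<..<30}\<close> \<open>r' \<in> {0<..<30}\<close> show False by simp
  qed
  have "(\<Prod>s\<in>nat ` R \<union> (\<lambda>r. nat (60 - r)) ` R. qprod (q ^ s) (q ^ 60)) =
      (\<Prod>s\<in>nat ` R. qprod (q ^ s) (q ^ 60)) * (\<Prod>s\<in>(\<lambda>r. nat (60 - r)) ` R. qprod (q ^ s) (q ^ 60))"
    using fin disj by (intro prod.union_disjoint) auto
  also have "\<dots> = (\<Prod>s\<in>R. qprod (q ^ nat s) (q ^ 60)) * (\<Prod>s\<in>R. qprod (q ^ nat (60 - s)) (q ^ 60))"
    using R by (subst (1 2) prod.reindex) (auto simp: inj_on_def subset_iff eq_nat_nat_iff)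
  also have "\<dots> = (\<Prod>s\<in>R. jac (q ^ nat s) (q ^ 60))"
    unfolding prod.distrib [symmetric]
  proof (rule prod.cong)
    fix s assume "s \<in> R"
    hence "q ^ 60 / q ^ nat s = q ^ nat (60 - s)"
      using R q by (subst power_diff [symmetric]) (auto simp: nat_diff_distrib subset_iff)
    thus "qprod (q ^ nat s) (q ^ 60) * qprod (q ^ nat (60 - s)) (q ^ 60) = jac (q ^ nat s) (q ^ 60)"
      by (simp add: jac_def)
  qed simp
  finally have eq: "(\<Prod>s\<in>nat ` R \<union> (\<lambda>r. nat (60 - r)) ` R. qprod (q ^ s) (q ^ 60)) =
    (\<Prod>s\<in>R. jac (q ^ nat s) (q ^ 60))" .
  have "nat ` R \<union> (\<lambda>r. nat (60 - r)) ` R \<subseteq> {0<..<60}"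
    using R by (auto simp: subset_iff)
  from part_gf_residue_class[OF this q(1)] show ?thesis
    unfolding pm_residues_60[OF R] eq .
qed

text \<open>Integer entries, since the simplifier evaluates them in binary and natural numbers in unary.\<close>

fun add_part :: "nat \<Rightarrow> int list \<Rightarrow> int list \<Rightarrow> int list" where
  "add_part k acc [] = rev acc"
| "add_part k acc (x # xs) = add_part k ((case drop (k - 1) acc of [] \<Rightarrow> x | y # _ \<Rightarrow> x + y) # acc) xs"

text \<open>\<open>acc\<close> holds the values already computed, newest first, so its entry
  \<open>k - 1\<close> is the value k places back, and each step applies the recurrence of
  \<open>num_partitions_insert\<close>. If fewer than k values exist, \<open>drop\<close> yields the
  empty list and nothing is added.\<close>

lemma add_part_correct:
  assumes "k \<notin> A" "0 \<notin> A" "k > 0" "m \<le> L"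
  shows "add_part k (map (\<lambda>n. int (num_partitions (insert k A) n)) (rev [0..<m]))
             (map (\<lambda>n. int (num_partitions A n)) [m..<L]) =
           map (\<lambda>n. int (num_partitions (insert k A) n)) [0..<L]"
  using assms(4)
proof (induction "L - m" arbitrary: m)
  case 0
  thus ?case by (simp add: rev_map)
next
  case (Suc d m)
  let ?a = "\<lambda>n. int (num_partitions A n)"
  let ?b = "\<lambda>n. int (num_partitions (insert k A) n)"
  have m: "m < L" using Suc by simp
  have rev_upt_Suc: "rev [0..<Suc m] = m # rev [0..<m]" by simp
  have "(case drop (k - 1) (map ?b (rev [0..<m])) of [] \<Rightarrow> ?a m | y # _ \<Rightarrow> ?a m + y) = ?b m"
  proof (cases "k \<le> m")
    case True
    hence "drop (k - 1) (map ?b (rev [0..<m])) =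
        map ?b (rev [0..<m]) ! (k - 1) # drop (Suc (k - 1)) (map ?b (rev [0..<m]))"
      using assms(3) by (intro Cons_nth_drop_Suc [symmetric]) simp
    also have "map ?b (rev [0..<m]) ! (k - 1) = ?b (m - k)"
      using True assms(3) by (auto simp: rev_nth)
    finally show ?thesis
      using num_partitions_insert[OF assms(1-3), of m] True by simp
  next
    case False
    hence "drop (k - 1) (map ?b (rev [0..<m])) = []" by simp
    thus ?thesis using num_partitions_insert[OF assms(1-3), of m] False by simp
  qed
  hence "add_part k (map ?b (rev [0..<m])) (map ?a [m..<L]) =
      add_part k (map ?b (rev [0..<Suc m])) (map ?a [Suc m..<L])"
    unfolding upt_conv_Cons[OF m] rev_upt_Suc by simp
  also have "\<dots> = map ?b [0..<L]"
    using Suc m by (intro Suc.hyps) auto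
  finally show ?case .
qed

definition partition_list :: "nat \<Rightarrow> nat list \<Rightarrow> int list" where
  "partition_list L ks = foldr (\<lambda>k. add_part k []) ks (map (\<lambda>n. if n = 0 then 1 else 0) [0..<L])"

lemma partition_list_correct:
  assumes "distinct ks" "0 \<notin> set ks"
  shows "partition_list L ks = map (\<lambda>n. int (num_partitions (set ks) n)) [0..<L]"
  using assms
proof (induction ks)
  case Nil
  show ?case by (simp add: partition_list_def num_partitions_empty)
next
  case (Cons k ks)
  thus ?case
    using add_part_correct[of k "set ks" 0 L] by (simp add: partition_list_def)
qed

section \<open>The partition identities\<close>

lemma powser_shift_isCont:
  fixes c :: "nat \<Rightarrow> complex"
  assumes "\<And>q. norm q < 1 \<Longrightarrow> summable (\<lambda>n. c n * q ^ n)"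
  shows "isCont (\<lambda>q. \<Sum>n. c (n + m) * q ^ n) 0"
proof (rule isCont_powser)
  have "summable (\<lambda>n. c (n + m) * (1/2) ^ (n + m))"
    by (subst summable_iff_shift[where f = "\<lambda>n. c n * (1/2) ^ n"]) (rule assms, simp)
  hence "summable (\<lambda>n. (1/2) ^ m * (c (n + m) * (1/2) ^ n))"
    by (simp only: power_add mult_ac)
  thus "summable (\<lambda>n. c (n + m) * (1/2) ^ n)"
    by (rule summable_mult_D) simp
qed simp

lemma powser_shift:
  fixes c :: "nat \<Rightarrow> complex"
  assumes "summable (\<lambda>n. c n * q ^ n)" "\<And>i. i < m \<Longrightarrow> c i = 0" "q \<noteq> 0"
  shows "(\<Sum>n. c n * q ^ n) = q ^ m * (\<Sum>n. c (n + m) * q ^ n)"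
proof -
  have "(\<lambda>n. c (n + m) * q ^ (n + m)) sums (\<Sum>n. c n * q ^ n)"
    by (subst sums_zero_iff_shift[where f = "\<lambda>n. c n * q ^ n"]) (use assms in auto)
  hence "(\<lambda>n. q ^ m * (c (n + m) * q ^ n)) sums (\<Sum>n. c n * q ^ n)"
    by (simp only: power_add mult_ac)
  hence "(\<lambda>n. c (n + m) * q ^ n) sums ((\<Sum>n. c n * q ^ n) / q ^ m)"
    using assms(3) sums_mult[of _ _ "1 / q ^ m"] by fastforce
  thus ?thesis using assms(3) by (simp add: sums_iff)
qed

text \<open>Once the lower coefficients vanish, the n-th one is the limit at 0 of the series divided
  by q^n. The point q = 0 is left out of the hypothesis because the parametrization by
  \<open>ee\<close> never reaches it.\<close>

lemma powser_eq_0_imp_coeff_eq_0: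
  fixes c :: "nat \<Rightarrow> complex"
  assumes sm: "\<And>q. norm q < 1 \<Longrightarrow> summable (\<lambda>n. c n * q ^ n)"
    and zero: "\<And>q. norm q < 1 \<Longrightarrow> q \<noteq> 0 \<Longrightarrow> (\<Sum>n. c n * q ^ n) = 0"
  shows "c n = 0"
proof (induction n rule: less_induct)
  case (less n)
  define g where "g = (\<lambda>q. \<Sum>i. c (i + n) * q ^ i)"
  have "g q = 0" if "norm q < 1" "q \<noteq> 0" for q
    using powser_shift[OF sm less, of q] zero[of q] that by (simp add: g_def)
  hence "eventually (\<lambda>q. g q = 0) (at 0)"
    unfolding eventually_at by (intro exI[of _ 1]) auto
  hence "(g \<longlongrightarrow> 0) (at 0)"
    by (rule tendsto_eventually)
  moreover have "(g \<longlongrightarrow> g 0) (at 0)"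
    using powser_shift_isCont[OF sm] by (simp add: g_def isCont_def)
  ultimately have "g 0 = 0"
    by (metis LIM_unique)
  thus ?case by (simp add: g_def)
qed

text \<open>The coefficients of gf(S) - q^d gf(T) - q^e; the guard is needed because natural
  subtraction truncates.\<close>

definition diff_coeff :: "nat set \<Rightarrow> nat set \<Rightarrow> nat \<Rightarrow> nat \<Rightarrow> nat \<Rightarrow> complex" where
  "diff_coeff S T d e n = of_nat (num_partitions S n)
     - (if d \<le> n then of_nat (num_partitions T (n - d)) else 0) - (if n = e then 1 else 0)"

lemma diff_coeff_sums:
  assumes "0 \<notin> S" "0 \<notin> T" "norm q < 1"
  shows "(\<lambda>n. diff_coeff S T d e n * q ^ n) sums (part_gf S q - q ^ d * part_gf T q - q ^ e)"
proof -
  have gf: "(\<lambda>n. of_nat (num_partitions A n) * q ^ n) sums part_gf A q" if "0 \<notin> A" for A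
    unfolding part_gf_def using summable_part_gf[OF that assms(3)] by (rule summable_sums)
  have "(\<lambda>n. of_nat (num_partitions S n) * q ^ n
      - q ^ d * (if d \<le> n then of_nat (num_partitions T (n - d)) * q ^ (n - d) else 0)
      - (if n = e then q ^ n else 0)) sums (part_gf S q - q ^ d * part_gf T q - q ^ e)"
    by (intro sums_diff sums_mult sums_shifted[where f = "\<lambda>n. of_nat (num_partitions T n) * q ^ n"]
          gf assms sums_single)
  moreover have "of_nat (num_partitions S n) * q ^ n
      - q ^ d * (if d \<le> n then of_nat (num_partitions T (n - d)) * q ^ (n - d) else 0)
      - (if n = e then q ^ n else 0) = diff_coeff S T d e n * q ^ n" for n
  proof -
    have "q ^ d * q ^ (n - d) = q ^ n" if "d \<le> n"
      using that by (simp add: power_add [symmetric])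
    thus ?thesis by (auto simp: diff_coeff_def algebra_simps)
  qed
  ultimately show ?thesis by simp
qed

lemma zero_not_pm_residues: "0 \<notin> pm_residues R M"
  by (simp add: pm_residues_def)

section \<open>From products of Siegel functions to partition series\<close>

lemma sieg_60_explicit:
  assumes "0 < n"
  shows "sieg (of_int n / 60) 0 \<tau> =
           ee (of_int (n * n - 60 * n) / 7200 * \<tau>) * jac (ee (\<tau> / 60) ^ nat n) (ee (\<tau> / 60) ^ 60)"
proof -
  have 1: "ee (of_int n / 60 * \<tau> + 0) = ee (\<tau> / 60) ^ nat n"
    unfolding ee_power using assms by (intro arg_cong[of _ _ ee]) simp
  have 2: "ee \<tau> = ee (\<tau> / 60) ^ 60"
    by (simp add: ee_power)
  have 3: "ee ((of_int n / 60 - 1) * (of_int n / 60 * \<tau> + 0) / 2) = ee (of_int (n * n - 60 * n) / 7200 * \<tau>)"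
    by (intro arg_cong[of _ _ ee]) (simp add: field_simps)
  show ?thesis unfolding sieg_def 1 2 [symmetric] 3 ..
qed

text \<open>\<open>E\<close> is the leading exponent of the Siegel product in q =
  \<open>ee (\<tau> / 60)\<close>, and the 60 in \<open>E - 60\<close> is the contribution of
  \<open>ee \<tau>\<close>. The values of \<open>sieg\<close> at n/60 are antiperiodic under n + 60
  and symmetric under 60 - n; stating \<open>SR\<close> for every such \<open>K\<close> reduces the
  passage from the multiples s u to residues in \<open>R\<close>, with all signs, to a finite
  computation.\<close>

lemma inverse_siegprod_eq_part_gf:
  assumes R: "R \<subseteq> {0<..<30}" and E: "(\<Sum>n\<in>R. n * n - 60 * n) = 120 * (E - 60)"
    and SR: "\<And>K :: int \<Rightarrow> complex. (\<And>n. K (n + 60) = - K n) \<Longrightarrow> (\<And>n. K (60 - n) = K n) \<Longrightarrow>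
               (\<Prod>s\<in>S. K (s * u)) = (\<Prod>n\<in>R. K n)"
    and \<tau>: "Im \<tau> > 0"
  shows "1 / siegprod S (u, 0) \<tau> = ee (- (of_int E * \<tau> / 60)) * part_gf (pm_residues R 60) (ee (\<tau> / 60))"
proof -
  define K where "K = (\<lambda>n. sieg (of_int n / 60) 0 \<tau>)"
  define x where "x = ee (\<tau> / 60)"
  have K60: "K (n + 60) = - K n" for n
    using sieg_shift1[OF \<tau>, of "of_int n / 60" 0] by (simp add: K_def add_divide_distrib)
  moreover have "K (60 - n) = K n" for n
  proof -
    have "K (60 - n) = - K (- n)" using K60[of "- n"] by simp
    also have "K (- n) = - K n"
      using sieg_uminus[OF \<tau>, of "of_int n / 60" 0] by (simp add: K_def)
    finally show ?thesis by simp
  qed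
  ultimately have "(\<Prod>s\<in>S. K (s * u)) = (\<Prod>n\<in>R. K n)"
    by (rule SR)
  also have "\<dots> = (\<Prod>n\<in>R. ee (of_int (n * n - 60 * n) / 7200 * \<tau>) * jac (x ^ nat n) (x ^ 60))"
    unfolding K_def x_def using R by (intro prod.cong refl sieg_60_explicit) auto
  also have "\<dots> = ee (\<Sum>n\<in>R. of_int (n * n - 60 * n) / 7200 * \<tau>) * (\<Prod>n\<in>R. jac (x ^ nat n) (x ^ 60))"
    unfolding prod.distrib ee_sum ..
  also have "(\<Sum>n\<in>R. of_int (n * n - 60 * n) / 7200 * \<tau>) = of_int (\<Sum>n\<in>R. n * n - 60 * n) / 7200 * \<tau>"
    by (simp only: of_int_sum sum_distrib_right sum_divide_distrib)
  finally have "siegprod S (u, 0) \<tau> = ee \<tau> * ee (of_int (120 * (E - 60)) / 7200 * \<tau>) * (\<Prod>n\<in>R. jac (x ^ nat n) (x ^ 60))"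
    unfolding E siegprod_def K_def by simp
  also have "ee \<tau> * ee (of_int (120 * (E - 60)) / 7200 * \<tau>) = ee (of_int E * \<tau> / 60)"
    unfolding ee_add [symmetric] by (intro arg_cong[of _ _ ee]) (simp add: field_simps)
  finally have *: "siegprod S (u, 0) \<tau> = ee (of_int E * \<tau> / 60) * (\<Prod>n\<in>R. jac (x ^ nat n) (x ^ 60))" .
  have "part_gf (pm_residues R 60) x * (\<Prod>n\<in>R. jac (x ^ nat n) (x ^ 60)) = 1"
    using part_gf_pm_residues[OF R, of x] \<tau> by (simp add: x_def norm_ee_less_1)
  hence gf: "1 / (\<Prod>n\<in>R. jac (x ^ nat n) (x ^ 60)) = part_gf (pm_residues R 60) x"
    by (metis mult_zero_right nonzero_eq_divide_eq zero_neq_one)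
  show ?thesis
    unfolding * x_def [symmetric] ee_minus gf [symmetric] by simp
qed

text \<open>Every index is first reduced to a residue between 0 and 30; naming the reduced function
  differently keeps the rewriting terminating.\<close>

lemma antiperiodic_reduce:
  fixes K :: "int \<Rightarrow> complex"
  assumes "\<And>n. K (n + 60) = - K n" "\<And>n. K (60 - n) = K n" "K' = K"
  shows "K m = (if even (m div 60) then 1 else - 1) * K' (if m mod 60 \<le> 30 then m mod 60 else 60 - m mod 60)"
proof -
  have nat: "K (n + 60 * int j) = (if even j then 1 else - 1) * K n" for n j
  proof (induction j)
    case (Suc j)
    have "K (n + 60 * int (Suc j)) = K (n + 60 * int j + 60)" by (simp add: algebra_simps)
    thus ?case using assms(1) Suc by simp
  qed simp
  have int: "K (n + 60 * j) = (if even j then 1 else - 1) * K n" for n j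
  proof (cases "j \<ge> 0")
    case True
    thus ?thesis using nat[of n "nat j"] by (simp add: even_nat_iff)
  next
    case False
    thus ?thesis using nat[of "n + 60 * j" "nat (- j)"] by (auto simp: even_nat_iff split: if_splits)
  qed
  have "K m = (if even (m div 60) then 1 else - 1) * K (m mod 60)"
    using int[of "m mod 60" "m div 60"] by simp
  thus ?thesis using assms(2)[of "m mod 60"] assms(3) by simp
qed

text \<open>The Euclidean algorithm for (7, 60), with signed remainders, read backwards:
  translations are the division steps and inversions swap the entries. The units 29 and 23 are
  reached in the same way.\<close>

lemma orbit_7: "(7, 0) \<in> orbit"
proof -
  have "(1, 56) \<in> orbit" using orbit_T_int[OF orbit_base, of "-4"] by simp
  from orbit_S_inverse[OF this] have "(4, 1) \<in> orbit" by simp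
  from orbit_T_int[OF this, of "-2"] have "(4, 53) \<in> orbit" by simp
  from orbit_S_inverse[OF this] have "(7, 4) \<in> orbit" by simp
  from orbit_T_int[OF this, of 8] show ?thesis by simp
qed

lemma orbit_29: "(29, 0) \<in> orbit"
proof -
  have "(1, 58) \<in> orbit" using orbit_T_int[OF orbit_base, of "-2"] by simp
  from orbit_S_inverse[OF this] have "(2, 1) \<in> orbit" by simp
  from orbit_T_int[OF this, of "-15"] have "(2, 31) \<in> orbit" by simp
  from orbit_S_inverse[OF this] have "(29, 2) \<in> orbit" by simp
  from orbit_T_int[OF this, of 2] show ?thesis by simp
qed

lemma orbit_23: "(23, 0) \<in> orbit"
proof -
  have "(1, 56) \<in> orbit" using orbit_T_int[OF orbit_base, of "-4"] by simp
  from orbit_S_inverse[OF this] have "(4, 1) \<in> orbit" by simp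
  from orbit_T_int[OF this, of 2] have "(4, 9) \<in> orbit" by simp
  from orbit_S_inverse[OF this] have "(51, 4) \<in> orbit" by simp
  from orbit_T_int[OF this, of 3] have "(51, 37) \<in> orbit" by simp
  from orbit_S_inverse[OF this] have "(23, 51) \<in> orbit" by simp
  from orbit_T_int[OF this, of 3] show ?thesis by simp
qed

section \<open>The finite check and its transfer to all four identities\<close>

lemma num_partitions_agree:
  assumes "n < 76"
  shows "num_partitions (pm_residues resS 60) n =
    (if n = 0 then 1 else num_partitions (pm_residues resT 60) (n - 1))"
proof -
  \<comment> \<open>The elements up to 75 of the two sets of parts; larger parts do not affect the
    coefficients compared.\<close>
  define ks :: "nat list" where "ks = [1, 6, 7, 8, 11, 13, 18, 19, 20, 21, 23, 25, 35, 37, 39, 40, 41, 42, 47, 49, 52, 53, 54, 59, 61, 66, 67, 68, 71, 73]"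
  define ls :: "nat list" where "ls = [1, 5, 6, 7, 13, 17, 18, 19, 20, 21, 28, 29, 31, 32, 39, 40, 41, 42, 43, 47, 53, 54, 55, 59, 61, 65, 66, 67, 73]"
  have S: "pm_residues resS 60 \<inter> {..75} = set ks"
  proof -
    have "pm_residues resS 60 \<inter> {..75} = {n \<in> {..75}. n mod 60 \<in> nat ` resS \<union> (\<lambda>r. nat (60 - r)) ` resS}"
      by (subst pm_residues_60) auto
    also have "\<dots> = set ks"
      unfolding ks_def by code_simp
    finally show ?thesis .
  qed
  have T: "pm_residues resT 60 \<inter> {..75} = set ls"
  proof -
    have "pm_residues resT 60 \<inter> {..75} = {n \<in> {..75}. n mod 60 \<in> nat ` resT \<union> (\<lambda>r. nat (60 - r)) ` resT}"
      by (subst pm_residues_60) auto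
    also have "\<dots> = set ls"
      unfolding ls_def by code_simp
    finally show ?thesis .
  qed
  \<comment> \<open>Multiplication by q shifts the second list and drops its last entry; the
    prepended 1 is the constant term.\<close>
  have "partition_list 76 ks = 1 # take 75 (partition_list 76 ls)"
    unfolding ks_def ls_def by code_simp
  moreover have "distinct ks" "distinct ls" "0 \<notin> set ks" "0 \<notin> set ls"
    by (simp_all add: ks_def ls_def)
  ultimately have eq: "map (\<lambda>n. int (num_partitions (set ks) n)) [0..<76] =
      1 # take 75 (map (\<lambda>n. int (num_partitions (set ls) n)) [0..<76])"
    by (simp only: partition_list_correct not_False_eq_True)
  have "map (\<lambda>n. int (num_partitions (set ks) n)) [0..<76] ! n =
      (1 # take 75 (map (\<lambda>n. int (num_partitions (set ls) n)) [0..<76])) ! n"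
    unfolding eq ..
  hence "num_partitions (set ks) n = (if n = 0 then 1 else num_partitions (set ls) (n - 1))"
    using assms by (simp add: nth_Cons' del: upt_Suc split: if_splits)
  moreover have "num_partitions (pm_residues resS 60) n = num_partitions (set ks) n"
    unfolding S [symmetric] by (rule num_partitions_restrict [symmetric]) (use assms in simp)
  moreover have "num_partitions (pm_residues resT 60) (n - 1) = num_partitions (set ls) (n - 1)"
    unfolding T [symmetric] by (rule num_partitions_restrict [symmetric]) (use assms in simp)
  ultimately show ?thesis by simp
qed

lemma Phi_1_0_eq:
  assumes "Im \<tau> > 0"
  shows "Phi (1, 0) \<tau> = part_gf (pm_residues resS 60) (ee (\<tau> / 60))
           - ee (\<tau> / 60) ^ 1 * part_gf (pm_residues resT 60) (ee (\<tau> / 60)) - ee (\<tau> / 60) ^ 0"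
proof -
  have "1 / siegprod resS (1, 0) \<tau> = ee (- (of_int 0 * \<tau> / 60)) * part_gf (pm_residues resS 60) (ee (\<tau> / 60))"
    by (rule inverse_siegprod_eq_part_gf[OF _ _ _ assms]) (simp_all only: mult_1_right, simp_all)
  moreover have "1 / siegprod resT (1, 0) \<tau> = ee (- (of_int (-1) * \<tau> / 60)) * part_gf (pm_residues resT 60) (ee (\<tau> / 60))"
    by (rule inverse_siegprod_eq_part_gf[OF _ _ _ assms]) (simp_all only: mult_1_right, simp_all)
  ultimately show ?thesis by (simp add: Phi_def)
qed

text \<open>The series without its 76 vanishing leading coefficients is \<open>Phi (1, 0)\<close>
  divided by q^76, and it is continuous at q = 0.\<close>

lemma Phi_1_0_bigo: "Phi (1, 0) \<in> O[at_icusp](\<lambda>\<tau>. ee (of_real 76 * \<tau> / 60))"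
proof (rule bigoI_tendsto)
  define c where "c = diff_coeff (pm_residues resS 60) (pm_residues resT 60) 1 0"
  define g where "g = (\<lambda>q. \<Sum>n. c (n + 76) * q ^ n)"
  have sums: "(\<lambda>n. c n * q ^ n) sums (part_gf (pm_residues resS 60) q
      - q ^ 1 * part_gf (pm_residues resT 60) q - q ^ 0)" if "norm q < 1" for q
    unfolding c_def by (intro diff_coeff_sums zero_not_pm_residues that)
  have c0: "c i = 0" if "i < 76" for i
    using num_partitions_agree[OF that] by (auto simp: c_def diff_coeff_def)
  have "isCont g 0"
    unfolding g_def by (rule powser_shift_isCont) (use sums in \<open>auto simp: sums_iff\<close>)
  hence lim: "((\<lambda>\<tau>. g (ee (\<tau> / 60))) \<longlongrightarrow> g 0) at_icusp"
    using tendsto_ee_icusp by (rule isCont_tendsto_compose)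
  have "eventually (\<lambda>\<tau>. g (ee (\<tau> / 60)) = Phi (1, 0) \<tau> / ee (of_real 76 * \<tau> / 60)) at_icusp"
  proof (rule eventually_mono[OF eventually_icusp_upper])
    fix \<tau> :: complex assume \<tau>: "Im \<tau> > 0"
    define x where "x = ee (\<tau> / 60)"
    have x: "norm x < 1" "x \<noteq> 0" using \<tau> by (auto simp: x_def norm_ee_less_1)
    have "Phi (1, 0) \<tau> = (\<Sum>n. c n * x ^ n)"
      using sums[OF x(1)] Phi_1_0_eq[OF \<tau>] by (simp add: x_def sums_iff)
    also have "\<dots> = x ^ 76 * g x"
      unfolding g_def by (rule powser_shift) (use sums[OF x(1)] c0 x(2) in \<open>auto simp: sums_iff\<close>)
    also have "x ^ 76 = ee (of_real 76 * \<tau> / 60)"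
      by (simp add: x_def ee_power)
    finally show "g (ee (\<tau> / 60)) = Phi (1, 0) \<tau> / ee (of_real 76 * \<tau> / 60)"
      by (simp add: x_def)
  qed
  thus "((\<lambda>\<tau>. Phi (1, 0) \<tau> / ee (of_real 76 * \<tau> / 60)) \<longlongrightarrow> g 0) at_icusp"
    by (rule Lim_transform_eventually[OF lim])
qed auto

text \<open>In the characteristic \<open>(u, 0)\<close> the two reciprocals are q^(-e) gf(R) and
  q^(d - e) gf(R'). Multiplying the vanishing defect by q^e leaves the monomial q^e, so
  \<open>n = e\<close> is the only exception.\<close>

lemma partition_identity:
  assumes u: "(u, 0) \<in> orbit" and R: "R \<subseteq> {0<..<30}" "R' \<subseteq> {0<..<30}"
    and E: "(\<Sum>n\<in>R. n * n - 60 * n) = 120 * (int e - 60)"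
      "(\<Sum>n\<in>R'. n * n - 60 * n) = 120 * (int e - int d - 60)"
    and S: "\<And>K :: int \<Rightarrow> complex. (\<And>n. K (n + 60) = - K n) \<Longrightarrow> (\<And>n. K (60 - n) = K n) \<Longrightarrow>
              (\<Prod>s\<in>resS. K (s * u)) = (\<Prod>n\<in>R. K n)"
    and T: "\<And>K :: int \<Rightarrow> complex. (\<And>n. K (n + 60) = - K n) \<Longrightarrow> (\<And>n. K (60 - n) = K n) \<Longrightarrow>
              (\<Prod>s\<in>resT. K (s * u)) = (\<Prod>n\<in>R'. K n)"
    and n: "n \<ge> d" "n \<noteq> e"
  shows "num_partitions (pm_residues R 60) n = num_partitions (pm_residues R' 60) (n - d)"
proof -
  define c where "c = diff_coeff (pm_residues R 60) (pm_residues R' 60) d e"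
  have sums: "(\<lambda>n. c n * q ^ n) sums (part_gf (pm_residues R 60) q
      - q ^ d * part_gf (pm_residues R' 60) q - q ^ e)" if "norm q < 1" for q
    unfolding c_def by (intro diff_coeff_sums zero_not_pm_residues that)
  have "c n = 0"
  proof (rule powser_eq_0_imp_coeff_eq_0)
    fix q :: complex assume q: "norm q < 1" "q \<noteq> 0"
    \<comment> \<open>A preimage of \<open>q\<close> under \<open>ee (\<tau> / 60)\<close>; any
      branch of the logarithm serves, and \<open>norm q < 1\<close> puts it in the upper
      half-plane.\<close>
    define \<tau> where "\<tau> = 60 * (Ln q / (2 * of_real pi * \<i>))"
    have x: "ee (\<tau> / 60) = q"
      using q by (simp add: \<tau>_def ee_def)
    have \<tau>: "Im \<tau> > 0"
    proof -
      have "exp (- 2 * pi * Im (\<tau> / 60)) < 1" using q x norm_ee[of "\<tau> / 60"] by simp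
      thus ?thesis by (simp add: zero_less_mult_iff)
    qed
    have e1: "ee (- (of_int (int e) * \<tau> / 60)) = 1 / q ^ e"
      unfolding ee_minus x [symmetric] ee_power by simp
    have e2: "ee (- (of_int (int e - int d) * \<tau> / 60)) = q ^ d / q ^ e"
      unfolding x [symmetric] ee_power ee_diff [symmetric]
      by (intro arg_cong[of _ _ ee]) (simp add: field_simps)
    have gf1: "1 / siegprod resS (u, 0) \<tau> = 1 / q ^ e * part_gf (pm_residues R 60) q"
      using inverse_siegprod_eq_part_gf[OF R(1) E(1) _ \<tau>, where S = resS and u = u] S unfolding e1 x by blast
    have gf2: "1 / siegprod resT (u, 0) \<tau> = q ^ d / q ^ e * part_gf (pm_residues R' 60) q"
      using inverse_siegprod_eq_part_gf[OF R(2) E(2) _ \<tau>, where S = resT and u = u] T unfolding e2 x by blast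
    have "0 = Phi (u, 0) \<tau>"
      using Phi_orbit_eq_0[OF Phi_1_0_bigo u \<tau>] by simp
    also have "\<dots> = 1 / q ^ e * part_gf (pm_residues R 60) q - q ^ d / q ^ e * part_gf (pm_residues R' 60) q - 1"
      unfolding Phi_def gf1 gf2 ..
    finally have "part_gf (pm_residues R 60) q - q ^ d * part_gf (pm_residues R' 60) q - q ^ e = 0"
      using q by (simp add: field_simps)
    thus "(\<Sum>n. c n * q ^ n) = 0"
      using sums[OF q(1)] by (simp add: sums_iff)
  qed (use sums in \<open>auto simp: sums_iff\<close>)
  thus ?thesis
    using n by (simp add: c_def diff_coeff_def)
qed

lemma partitions_i:
  "n \<ge> 1 \<Longrightarrow> num_partitions (pm_residues resS 60) n = num_partitions (pm_residues resT 60) (n - 1)"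
  by (rule partition_identity[OF orbit_base, where e = 0]) (simp_all only: mult_1_right, simp_all)

lemma partitions_ii:
  "n \<ge> 4 \<Longrightarrow> num_partitions (pm_residues {4, 5, 6, 7, 11, 13, 17, 18, 19, 20, 27, 29} 60) n =
    num_partitions (pm_residues {1, 6, 7, 11, 13, 16, 18, 20, 23, 25, 27, 29} 60) (n - 4)"
proof (rule partition_identity[OF orbit_7, where e = 0])
  fix K :: "int \<Rightarrow> complex" assume K: "\<And>n. K (n + 60) = - K n" "\<And>n. K (60 - n) = K n"
  define K' where "K' = K"
  show "(\<Prod>s\<in>resS. K (s * 7)) = (\<Prod>n\<in>{4, 5, 6, 7, 11, 13, 17, 18, 19, 20, 27, 29}. K n)"
    by (simp add: antiperiodic_reduce[of K, OF K K'_def])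
  show "(\<Prod>s\<in>resT. K (s * 7)) = (\<Prod>n\<in>{1, 6, 7, 11, 13, 16, 18, 20, 23, 25, 27, 29}. K n)"
    by (simp add: antiperiodic_reduce[of K, OF K K'_def])
qed simp_all

lemma partitions_iii:
  "n \<ge> 5 \<Longrightarrow> num_partitions (pm_residues {5, 6, 7, 8, 9, 11, 17, 18, 19, 20, 23, 29} 60) n =
    num_partitions (pm_residues {1, 6, 9, 11, 13, 17, 18, 20, 23, 25, 28, 29} 60) (n - 5)"
proof (rule partition_identity[OF orbit_29, where e = 0])
  fix K :: "int \<Rightarrow> complex" assume K: "\<And>n. K (n + 60) = - K n" "\<And>n. K (60 - n) = K n"
  define K' where "K' = K"
  show "(\<Prod>s\<in>resS. K (s * 29)) = (\<Prod>n\<in>{5, 6, 7, 8, 9, 11, 17, 18, 19, 20, 23, 29}. K n)"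
    by (simp add: antiperiodic_reduce[of K, OF K K'_def])
  show "(\<Prod>s\<in>resT. K (s * 29)) = (\<Prod>n\<in>{1, 6, 9, 11, 13, 17, 18, 20, 23, 25, 28, 29}. K n)"
    by (simp add: antiperiodic_reduce[of K, OF K K'_def])
qed simp_all

lemma partitions_iv:
  "n \<noteq> 4 \<Longrightarrow> num_partitions (pm_residues {1, 3, 4, 6, 11, 13, 17, 18, 19, 20, 23, 25} 60) n =
    num_partitions (pm_residues {1, 3, 5, 6, 7, 16, 17, 18, 19, 20, 23, 29} 60) n"
proof -
  assume n: "n \<noteq> 4"
  have "num_partitions (pm_residues {1, 3, 4, 6, 11, 13, 17, 18, 19, 20, 23, 25} 60) n =
    num_partitions (pm_residues {1, 3, 5, 6, 7, 16, 17, 18, 19, 20, 23, 29} 60) (n - 0)"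
  \<comment> \<open>Here both leading exponents equal 4, so there is no shift, \<open>d = 0\<close>,
    and the defect sits at q^4.\<close>
  proof (rule partition_identity[OF orbit_23, where e = 4])
    fix K :: "int \<Rightarrow> complex" assume K: "\<And>n. K (n + 60) = - K n" "\<And>n. K (60 - n) = K n"
    define K' where "K' = K"
    show "(\<Prod>s\<in>resS. K (s * 23)) = (\<Prod>n\<in>{1, 3, 4, 6, 11, 13, 17, 18, 19, 20, 23, 25}. K n)"
      by (simp add: antiperiodic_reduce[of K, OF K K'_def])
    show "(\<Prod>s\<in>resT. K (s * 23)) = (\<Prod>n\<in>{1, 3, 5, 6, 7, 16, 17, 18, 19, 20, 23, 29}. K n)"
      by (simp add: antiperiodic_reduce[of K, OF K K'_def])
  qed (use n in simp_all)
  thus ?thesis by simp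
qed

theorem theorem12p8:
  shows
    "(let S = pm_residues {1, 6, 7, 8, 11, 13, 18, 19, 20, 21, 23, 25} 60;
          T = pm_residues {1, 5, 6, 7, 13, 17, 18, 19, 20, 21, 28, 29} 60
      in \<forall>n\<ge>1. num_partitions S n = num_partitions T (n - 1)) \<and>
     (let S = pm_residues {4, 5, 6, 7, 11, 13, 17, 18, 19, 20, 27, 29} 60;
          T = pm_residues {1, 6, 7, 11, 13, 16, 18, 20, 23, 25, 27, 29} 60
      in \<forall>n\<ge>4. num_partitions S n = num_partitions T (n - 4)) \<and>
     (let S = pm_residues {5, 6, 7, 8, 9, 11, 17, 18, 19, 20, 23, 29} 60;
          T = pm_residues {1, 6, 9, 11, 13, 17, 18, 20, 23, 25, 28, 29} 60
      in \<forall>n\<ge>5. num_partitions S n = num_partitions T (n - 5)) \<and>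
     (let S = pm_residues {1, 3, 4, 6, 11, 13, 17, 18, 19, 20, 23, 25} 60;
          T = pm_residues {1, 3, 5, 6, 7, 16, 17, 18, 19, 20, 23, 29} 60
      in \<forall>n. n \<noteq> 4 \<longrightarrow> num_partitions S n = num_partitions T n)"
  using partitions_i partitions_ii partitions_iii partitions_iv unfolding Let_def by blast

end
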